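(* Fix an integer $m\ge 1$ and a real number $s\in\,]0,m[$, put $\delta:=\sqrt{m-s}$ and $$\rho:=\frac{m}{2}\Big(-1+\big(1-\tfrac{s}{m}\big)^{-1/2}\Big).$$ Then, as $n\to+\infty$, every $\delta$-code $C\subset\mathcal G_{m,n}$ satisfies the asymptotic inequality $$\frac1n\log|C|\lesssim m\big((1+\rho)\log(1+\rho)-\rho\log\rho\big),$$ that is, $\displaystyle\limsup_{n\to\infty}\ \max_{C\ \delta\text{-code in }\mathcal G_{m,n}}\frac1n\log|C|\le m\big((1+\rho)\log(1+\rho)-\rho\log\rho\big)$ (natural logarithms).
   Context: For integers $1\le m\le n/2$, $\mathcal G_{m,n}$ is the set of $m$-dimensional linear subspaces of $\mathbb R^n$. For $p,q\in\mathcal G_{m,n}$ the principal angles $\theta_1,\dots,\theta_m\in[0,\pi/2]$ are defined recursively: $\theta_1$ is the minimal angle between a line $p_1\subset p$ and a line $q_1\subset q$, and $\theta_2,\dots,\theta_m$ are the principal angles between the orthogonal complement of $p_1$ in $p$ and that of $q_1$ in $q$. Put $y_i(p,q)=\cos^2\theta_i$. The chordal distance is $d_c(p,q)=\sqrt{m-\sum_{i=1}^m y_i(p,q)}$. A $\delta$-code is a finite set $C\subset\mathcal G_{m,n}$ with $d_c(p,q)\ge\delta$ for all $p\ne q$ in $C$. *)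

theory Defs
  imports "HOL-Analysis.Analysis"
begin

definition Rn :: "nat \<Rightarrow> (nat \<Rightarrow> real) set" where
  "Rn n = {x. \<forall>i\<ge>n. x i = 0}"

definition ipn :: "nat \<Rightarrow> (nat \<Rightarrow> real) \<Rightarrow> (nat \<Rightarrow> real) \<Rightarrow> real" where
  "ipn n x y = (\<Sum>i<n. x i * y i)"

definition lincomb :: "nat \<Rightarrow> (nat \<Rightarrow> real) \<Rightarrow> (nat \<Rightarrow> nat \<Rightarrow> real) \<Rightarrow> (nat \<Rightarrow> real)" where
  "lincomb m c b = (\<lambda>j. \<Sum>i<m. c i * b i j)"

definition Grass :: "nat \<Rightarrow> nat \<Rightarrow> (nat \<Rightarrow> real) set set" where
  "Grass m n = {V. \<exists>b. (\<forall>i<m. b i \<in> Rn n)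
      \<and> (\<forall>c. lincomb m c b = (\<lambda>_. 0) \<longrightarrow> (\<forall>i<m. c i = 0))
      \<and> V = {lincomb m c b | c. True}}"

text \<open>Squared cosines of principal angles, by the recursive definition:
choose unit vectors u in P and v in Q spanning lines of minimal angle
(i.e. maximising |u.v|), record cos^2 = (u.v)^2, and recurse on the orthogonal
complements of u in P and of v in Q.\<close>

fun cos2_angles :: "nat \<Rightarrow> nat \<Rightarrow> (nat \<Rightarrow> real) set \<Rightarrow> (nat \<Rightarrow> real) set \<Rightarrow> real list" where
  "cos2_angles n 0 P Q = []"
| "cos2_angles n (Suc k) P Q =
     (let (u, v) = (SOME (u, v). u \<in> P \<and> v \<in> Q \<and> ipn n u u = 1 \<and> ipn n v v = 1 \<and>
                      (\<forall>u'\<in>P. \<forall>v'\<in>Q. ipn n u' u' = 1 \<longrightarrow> ipn n v' v' = 1 \<longrightarrow>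
                          \<bar>ipn n u' v'\<bar> \<le> \<bar>ipn n u v\<bar>))
      in (ipn n u v)\<^sup>2 # cos2_angles n k {x\<in>P. ipn n x u = 0} {y\<in>Q. ipn n y v = 0})"

definition chordal_dist :: "nat \<Rightarrow> nat \<Rightarrow> (nat \<Rightarrow> real) set \<Rightarrow> (nat \<Rightarrow> real) set \<Rightarrow> real" where
  "chordal_dist m n p q = sqrt (real m - sum_list (cos2_angles n m p q))"

definition is_code :: "nat \<Rightarrow> nat \<Rightarrow> real \<Rightarrow> (nat \<Rightarrow> real) set set \<Rightarrow> bool" where
  "is_code m n \<delta> C \<longleftrightarrow> finite C \<and> C \<subseteq> Grass m n \<and>
     (\<forall>p\<in>C. \<forall>q\<in>C. p \<noteq> q \<longrightarrow> chordal_dist m n p q \<ge> \<delta>)"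

end

theory Submission
  imports Defs
begin

text \<open>
Scale an orthonormal basis \<open>u\<^sub>1, \<dots>, u\<^sub>m\<close> of each code point by \<open>1 / sqrt m\<close> and stack it into
one unit vector of dimension \<open>mn\<close>. Since the sum of all \<open>(u\<^sub>i \<bullet> v\<^sub>j)\<^sup>2\<close> is the sum of the
\<open>cos\<^sup>2\<close> of the principal angles, Cauchy-Schwarz bounds the inner products of distinct stacked vectors by
\<open>sqrt (s / m)\<close>. The Kabatiansky-Levenshtein bound in dimension \<open>mn\<close> then gives the rate at
\<open>\<rho>' = ((1 - s/m) powr (-1/2) - 1) / 2\<close>, and \<open>\<rho>' \<le> \<rho>\<close>.

The spherical bound is the linear programming bound for \<open>(t - \<tau>) f(t)\<^sup>2\<close>, where \<open>f\<close> is a combination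
of orthonormal Gegenbauer polynomials of degrees in a window of constant length just above \<open>\<rho>\<close> times the dimension, with
weights \<open>j (R - j)\<close>. These weights make all coefficients of \<open>(t - \<tau>) f\<close> nonnegative, because \<open>t\<close> acts
on the window almost as \<open>\<sigma>/2\<close> times the sum of the two shifts, with \<open>\<sigma> > \<tau>\<close>. Products of Gegenbauer
polynomials have nonnegative expansions, and Gegenbauer polynomials are positive definite on the sphere.
\<close>

section \<open>Raising operators on the sphere\<close>

text \<open>Polynomials are kept as syntax trees so that derivatives can be defined by recursion and
  iterated.\<close>

datatype poly_expr = Var nat | Const real | Add poly_expr poly_expr | Mul poly_expr poly_expr

primrec ev :: "poly_expr \<Rightarrow> (nat \<Rightarrow> real) \<Rightarrow> real" where
  "ev (Var k) x = x k"
| "ev (Const c) x = c"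
| "ev (Add a b) x = ev a x + ev b x"
| "ev (Mul a b) x = ev a x * ev b x"

text \<open>The derivation x_j d/dx_i - x_i d/dx_j, the infinitesimal rotation in the (i, j) plane;
  it vanishes for \<open>i = j\<close>.\<close>

primrec rot_der :: "nat \<Rightarrow> nat \<Rightarrow> poly_expr \<Rightarrow> poly_expr" where
  "rot_der j i (Var k) = Add (if k = i then Var j else Const 0) (if k = j then Mul (Const (-1)) (Var i) else Const 0)"
| "rot_der j i (Const c) = Const 0"
| "rot_der j i (Add a b) = Add (rot_der j i a) (rot_der j i b)"
| "rot_der j i (Mul a b) = Add (Mul (rot_der j i a) b) (Mul a (rot_der j i b))"

definition rotate_coords :: "nat \<Rightarrow> nat \<Rightarrow> real \<Rightarrow> (nat \<Rightarrow> real) \<Rightarrow> (nat \<Rightarrow> real)" where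
  "rotate_coords j i \<theta> x = x(j := cos \<theta> * x j - sin \<theta> * x i, i := cos \<theta> * x i + sin \<theta> * x j)"

lemma rotate_coords_0 [simp]: "i \<noteq> j \<Longrightarrow> rotate_coords j i 0 x = x"
  by (auto simp: rotate_coords_def)

lemma ev_rot_der_same [simp]: "ev (rot_der i i e) x = 0"
  by (induction e) auto

lemma has_real_derivative_ev_rotate:
  assumes "i \<noteq> j"
  shows "((\<lambda>\<theta>. ev e (rotate_coords j i \<theta> x)) has_real_derivative ev (rot_der j i e) x) (at 0)"
proof (induction e)
  case (Var k)
  show ?case using assms
    by (cases "k = i"; cases "k = j") (auto simp: rotate_coords_def intro!: derivative_eq_intros)
next
  case (Mul a b)
  show ?case using assms by (auto intro!: derivative_eq_intros Mul)
qed (auto intro!: derivative_eq_intros)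

section \<open>Inner products under plane rotations\<close>

lemma ipn_commute: "ipn n x y = ipn n y x"
  by (simp add: ipn_def mult.commute)

lemma ipn_rotate_coords:
  assumes "i \<noteq> j" "i < n" "j < n"
  shows "ipn n (rotate_coords j i \<theta> x) y
    = ipn n x y + (cos \<theta> * x j - sin \<theta> * x i - x j) * y j + (cos \<theta> * x i + sin \<theta> * x j - x i) * y i"
proof -
  have "ipn n (rotate_coords j i \<theta> x) y - ipn n x y
      = (\<Sum>k<n. (if k = j then (cos \<theta> * x j - sin \<theta> * x i - x j) * y j else 0)
          + (if k = i then (cos \<theta> * x i + sin \<theta> * x j - x i) * y i else 0))"
    unfolding ipn_def sum_subtractf[symmetric] using assms
    by (intro sum.cong) (auto simp: rotate_coords_def algebra_simps)
  also have "\<dots> = (cos \<theta> * x j - sin \<theta> * x i - x j) * y j + (cos \<theta> * x i + sin \<theta> * x j - x i) * y i"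
    using assms by (simp add: sum.distrib)
  finally show ?thesis by simp
qed

lemma ipn_rotate_coords_self:
  assumes "i \<noteq> j" "i < n" "j < n"
  shows "ipn n (rotate_coords j i \<theta> x) (rotate_coords j i \<theta> x) = ipn n x x"
proof -
  have "(cos \<theta> * x j - sin \<theta> * x i)\<^sup>2 + (cos \<theta> * x i + sin \<theta> * x j)\<^sup>2 = (x j)\<^sup>2 + (x i)\<^sup>2"
  proof -
    have "(cos \<theta> * x j - sin \<theta> * x i)\<^sup>2 + (cos \<theta> * x i + sin \<theta> * x j)\<^sup>2
        = ((cos \<theta>)\<^sup>2 + (sin \<theta>)\<^sup>2) * ((x j)\<^sup>2 + (x i)\<^sup>2)" by algebra
    then show ?thesis by simp
  qed
  moreover have "ipn n (rotate_coords j i \<theta> x) (rotate_coords j i \<theta> x) 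
     = ipn n x x + (cos \<theta> * x j - sin \<theta> * x i)\<^sup>2 + (cos \<theta> * x i + sin \<theta> * x j)\<^sup>2 - ((x j)\<^sup>2 + (x i)\<^sup>2)"
    unfolding ipn_rotate_coords[OF assms] ipn_commute[of n x "rotate_coords _ _ _ _"] using assms(1)
    by (simp add: rotate_coords_def power2_eq_square algebra_simps)
  ultimately show ?thesis by simp
qed

lemma has_real_derivative_ipn_rotate:
  assumes "i \<noteq> j" "i < n" "j < n"
  shows "((\<lambda>\<theta>. ipn n (rotate_coords j i \<theta> x) y) has_real_derivative x j * y i - x i * y j) (at 0)"
  unfolding ipn_rotate_coords[OF assms]
  by (auto intro!: derivative_eq_intros simp: algebra_simps)

text \<open>On the unit sphere the sum over j of x_j (x_j d/dx_i - x_i d/dx_j) is d/dx_i minus x_i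
  times the radial derivative: component \<open>i\<close> of the tangential gradient.\<close>

definition tan_grad :: "nat \<Rightarrow> nat \<Rightarrow> poly_expr \<Rightarrow> poly_expr" where
  "tan_grad n i e = foldr Add (map (\<lambda>j. Mul (Var j) (rot_der j i e)) [0..<n]) (Const 0)"

lemma ev_tan_grad: "ev (tan_grad n i e) x = (\<Sum>j<n. x j * ev (rot_der j i e) x)"
proof -
  have "ev (foldr Add es (Const 0)) x = (\<Sum>e\<leftarrow>es. ev e x)" for es
    by (induction es) auto
  then show ?thesis
    by (simp add: tan_grad_def o_def interv_sum_list_conv_sum_set_nat atLeast0LessThan)
qed

text \<open>On the unit sphere this is minus the partial derivative d/dx_i of the extension of
  \<open>e\<close> that is homogeneous of degree \<open>- c\<close>.\<close>

definition raise_op :: "nat \<Rightarrow> real \<Rightarrow> nat \<Rightarrow> poly_expr \<Rightarrow> poly_expr" where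
  "raise_op n c i e = Add (Mul (Const c) (Mul (Var i) e)) (Mul (Const (-1)) (tan_grad n i e))"

lemma ev_raise_op:
  "ev (raise_op n c i e) x = c * x i * ev e x - (\<Sum>j<n. x j * ev (rot_der j i e) x)"
  by (simp add: raise_op_def ev_tan_grad)

text \<open>Rotations stay on the sphere, so an identity valid only on the unit sphere may be differentiated along them.\<close>

lemma rotate_derivative_unique:
  assumes ij: "i < n" "j < n" and x: "ipn n x x = 1"
    and eq: "\<And>x. ipn n x x = 1 \<Longrightarrow> (\<Sum>I\<in>A. w I * ev (\<phi> I) x) = G x"
    and G: "i \<noteq> j \<Longrightarrow> ((\<lambda>\<theta>. G (rotate_coords j i \<theta> x)) has_real_derivative G') (at 0)"
    and G0: "i = j \<Longrightarrow> G' = 0"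
  shows "(\<Sum>I\<in>A. w I * ev (rot_der j i (\<phi> I)) x) = G'"
proof (cases "i = j")
  case False
  have "((\<lambda>\<theta>. \<Sum>I\<in>A. w I * ev (\<phi> I) (rotate_coords j i \<theta> x)) has_real_derivative
      (\<Sum>I\<in>A. w I * ev (rot_der j i (\<phi> I)) x)) (at 0)"
    by (intro DERIV_sum DERIV_cmult has_real_derivative_ev_rotate False)
  moreover have "(\<lambda>\<theta>. \<Sum>I\<in>A. w I * ev (\<phi> I) (rotate_coords j i \<theta> x)) = (\<lambda>\<theta>. G (rotate_coords j i \<theta> x))"
    by (intro ext eq) (simp add: ipn_rotate_coords_self False ij x)
  ultimately show ?thesis using G[OF False] DERIV_unique by metis
qed (simp add: G0)

text \<open>The kernel identity may be differentiated along rotations, first in \<open>y\<close>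
  (\<open>D1\<close>, \<open>D2\<close>), then in \<open>x\<close> (\<open>D3\<close>,
  \<open>D4\<close>); summing over \<open>i\<close> leaves an expression in \<open>t\<close> alone.
  So a zonal kernel stays zonal when both of its factors are raised.\<close>

lemma zonal_raise:
  fixes p :: "real poly"
  assumes ker: "\<And>x y. ipn n x x = 1 \<Longrightarrow> ipn n y y = 1 \<Longrightarrow>
      (\<Sum>I\<in>A. ev (\<phi> I) x * ev (\<phi> I) y) = poly p (ipn n x y)"
    and x: "ipn n x x = 1" and y: "ipn n y y = 1"
  defines "t \<equiv> ipn n x y"
  shows "(\<Sum>i<n. \<Sum>I\<in>A. ev (raise_op n c i (\<phi> I)) x * ev (raise_op n c i (\<phi> I)) y)
    = c * t * (c * poly p t + t * poly (pderiv p) t)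
      - (1 - t\<^sup>2) * ((c + 1) * poly (pderiv p) t + t * poly (pderiv (pderiv p)) t)
      - (c - real n + 1) * poly (pderiv p) t"
proof -
  define p1 p2 where "p1 = pderiv p" and "p2 = pderiv p1"
  have d0: "((\<lambda>\<theta>. poly q (ipn n (rotate_coords j i \<theta> x) y)) has_real_derivative
      poly (pderiv q) (ipn n x y) * (x j * y i - x i * y j)) (at 0)"
    if "i \<noteq> j" "i < n" "j < n" for i j x y and q :: "real poly"
    using DERIV_chain2[OF poly_DERIV has_real_derivative_ipn_rotate, OF that, of q x y] that by simp
  have sq: "(\<Sum>j<n. x j * x j) = 1" if "ipn n x x = 1" for x using that by (simp add: ipn_def)
  have ip: "(\<Sum>j<n. x j * y j) = ipn n x y" for x y by (simp add: ipn_def)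
  have D1: "(\<Sum>I\<in>A. ev (\<phi> I) x * ev (rot_der j i (\<phi> I)) y)
      = poly p1 (ipn n x y) * (y j * x i - y i * x j)"
    if xy: "ipn n x x = 1" "ipn n y y = 1" and ij: "i < n" "j < n" for i j x y
  proof (rule rotate_derivative_unique[OF ij xy(2), where G = "\<lambda>y. poly p (ipn n y x)"], goal_cases)
    case (1 y) then show ?case using ker[OF xy(1) 1] by (simp add: ipn_commute)
  next
    case 2 then show ?case using d0[OF 2 ij, of p y x] by (simp add: p1_def ipn_commute)
  qed auto
  have D2: "(\<Sum>I\<in>A. ev (\<phi> I) x * ev (raise_op n c i (\<phi> I)) y)
      = y i * (c * poly p (ipn n x y) + ipn n x y * poly p1 (ipn n x y)) - x i * poly p1 (ipn n x y)"
    if xy: "ipn n x x = 1" "ipn n y y = 1" and i: "i < n" for i x y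
  proof -
    have "(\<Sum>I\<in>A. ev (\<phi> I) x * ev (raise_op n c i (\<phi> I)) y)
        = c * y i * (\<Sum>I\<in>A. ev (\<phi> I) x * ev (\<phi> I) y)
          - (\<Sum>j<n. y j * (\<Sum>I\<in>A. ev (\<phi> I) x * ev (rot_der j i (\<phi> I)) y))"
      unfolding sum_distrib_left sum.swap[where A = "{..<n}" and B = A] ev_raise_op sum_subtractf[symmetric]
      by (intro sum.cong refl) (simp add: algebra_simps sum_distrib_left)
    also have "(\<Sum>j<n. y j * (\<Sum>I\<in>A. ev (\<phi> I) x * ev (rot_der j i (\<phi> I)) y))
        = (\<Sum>j<n. y j * (poly p1 (ipn n x y) * (y j * x i - y i * x j)))"
      using D1 xy i by (intro sum.cong) auto
    also have "\<dots> = poly p1 (ipn n x y) * (x i * (\<Sum>j<n. y j * y j) - y i * (\<Sum>j<n. x j * y j))"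
      unfolding sum_distrib_left sum_subtractf[symmetric] by (intro sum.cong) (auto simp: algebra_simps)
    finally show ?thesis using xy by (simp add: sq ip ker algebra_simps)
  qed
  \<comment> \<open>Collects the coefficient of \<open>y i\<close> in \<open>D2\<close> as one
    polynomial in the inner product, so that the chain rule applies to it.\<close>
  define g where "g = smult c p + pCons 0 p1"
  have g: "poly g z = c * poly p z + z * poly p1 z" for z by (simp add: g_def)
  have g': "poly (pderiv g) z = (c + 1) * poly p1 z + z * poly p2 z" for z
    by (simp add: g_def pderiv_add pderiv_smult pderiv_pCons p1_def p2_def algebra_simps)
  \<comment> \<open>The explicit coordinate \<open>x i\<close> moves with velocity
    \<open>x j\<close> under the rotation, but only for \<open>i \<noteq> j\<close>; hence the
    \<open>if\<close>.\<close>
  have D3: "(\<Sum>I\<in>A. ev (raise_op n c i (\<phi> I)) y * ev (rot_der j i (\<phi> I)) x)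
      = y i * (poly (pderiv g) t * (x j * y i - x i * y j))
       - ((if i = j then 0 else x j) * poly p1 t + x i * (poly p2 t * (x j * y i - x i * y j)))"
    if ij: "i < n" "j < n" for i j
  proof (rule rotate_derivative_unique[OF ij x, 
        where G = "\<lambda>x. y i * poly g (ipn n x y) - x i * poly p1 (ipn n x y)"], goal_cases)
    case (1 x) then show ?case using D2[OF 1 y ij(1)] by (simp add: g mult.commute)
  next
    case 2
    have coord: "((\<lambda>\<theta>. rotate_coords j i \<theta> x i) has_real_derivative x j) (at 0)"
      using has_real_derivative_ev_rotate[OF 2, of "Var i" x] 2 by simp
    show ?case
      by (rule DERIV_cong[OF DERIV_diff[OF DERIV_cmult[OF d0[OF 2 ij, of g x y], of "y i"]
            DERIV_mult[OF coord d0[OF 2 ij, of p1 x y]]]])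
        (use 2 in \<open>simp add: t_def p2_def algebra_simps\<close>)
  qed auto
  have D4: "(\<Sum>I\<in>A. ev (raise_op n c i (\<phi> I)) x * ev (raise_op n c i (\<phi> I)) y)
      = c * x i * (y i * poly g t - x i * poly p1 t)
       - (y i * poly (pderiv g) t * (y i - x i * t) - (1 - x i * x i) * poly p1 t 
           - x i * poly p2 t * (y i - x i * t))"
    if i: "i < n" for i
  proof -
    have "(\<Sum>I\<in>A. ev (raise_op n c i (\<phi> I)) x * ev (raise_op n c i (\<phi> I)) y)
        = c * x i * (\<Sum>I\<in>A. ev (\<phi> I) x * ev (raise_op n c i (\<phi> I)) y)
          - (\<Sum>j<n. x j * (\<Sum>I\<in>A. ev (raise_op n c i (\<phi> I)) y * ev (rot_der j i (\<phi> I)) x))"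
      unfolding sum_distrib_left sum.swap[where A = "{..<n}" and B = A] sum_subtractf[symmetric]
      by (intro sum.cong refl) (simp add: ev_raise_op[of _ _ _ _ x] algebra_simps sum_distrib_left)
    also have "(\<Sum>j<n. x j * (\<Sum>I\<in>A. ev (raise_op n c i (\<phi> I)) y * ev (rot_der j i (\<phi> I)) x))
        = (\<Sum>j<n. x j * (y i * (poly (pderiv g) t * (x j * y i - x i * y j))
       - ((if i = j then 0 else x j) * poly p1 t + x i * (poly p2 t * (x j * y i - x i * y j)))))"
      using D3 i by (intro sum.cong) auto
    also have "\<dots> = (\<Sum>j<n. (y i * poly (pderiv g) t * y i - poly p1 t - x i * poly p2 t * y i) * (x j * x j) 
        + (x i * poly p2 t * x i - y i * poly (pderiv g) t * x i) * (x j * y j) 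
        + (if j = i then poly p1 t * (x i * x i) else 0))"
      by (intro sum.cong) (auto simp: algebra_simps)
    also have "\<dots> = (y i * poly (pderiv g) t * y i - poly p1 t - x i * poly p2 t * y i) * 1
        + (x i * poly p2 t * x i - y i * poly (pderiv g) t * x i) * t
        + poly p1 t * (x i * x i)"
      unfolding sum.distrib sum_distrib_left[symmetric] sq[OF x] ip t_def using i by simp
    finally show ?thesis
      using D2[OF x y i] by (simp add: g t_def algebra_simps)
  qed
  have "(\<Sum>i<n. \<Sum>I\<in>A. ev (raise_op n c i (\<phi> I)) x * ev (raise_op n c i (\<phi> I)) y)
      = (\<Sum>i<n. (c * poly g t + poly (pderiv g) t * t + poly p2 t) * (x i * y i)
         - poly (pderiv g) t * (y i * y i) + poly p1 t 
         - (c * poly p1 t + poly p1 t + poly p2 t * t) * (x i * x i))"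
    by (intro sum.cong refl) (simp add: D4 algebra_simps)
  also have "\<dots> = (c * poly g t + poly (pderiv g) t * t + poly p2 t) * t
         - poly (pderiv g) t + real n * poly p1 t
         - (c * poly p1 t + poly p1 t + poly p2 t * t)"
    unfolding sum.distrib sum_subtractf sum_distrib_left[symmetric] sq[OF x] sq[OF y] ip t_def by simp
  finally show ?thesis
    by (simp add: g g' p1_def[symmetric] p2_def[symmetric] algebra_simps power2_eq_square)
qed

section \<open>Positive definiteness of Gegenbauer polynomials\<close>

text \<open>Recurrence coefficients of the monic Gegenbauer polynomials with parameter
  \<open>(d - 2) / 2\<close>. For integer \<open>d\<close> these are orthogonal with respect to the
  distribution of one coordinate of a uniform point on the unit sphere in dimension
  \<open>d\<close>.\<close>

definition gegen_coeff :: "real \<Rightarrow> nat \<Rightarrow> real" where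
  "gegen_coeff d k = real k * (real k + d - 3) / ((2 * real k + d - 4) * (2 * real k + d - 2))"

fun gegen :: "real \<Rightarrow> nat \<Rightarrow> real poly" where
  "gegen d 0 = 1"
| "gegen d (Suc 0) = [:0, 1:]"
| "gegen d (Suc (Suc k)) = pCons 0 (gegen d (Suc k)) - smult (gegen_coeff d (Suc k)) (gegen d k)"

lemma gegen_coeff_0 [simp]: "gegen_coeff d 0 = 0"
  by (simp add: gegen_coeff_def)

text \<open>As \<open>gegen_coeff d 0 = 0\<close>, the truncated \<open>k - 1\<close> at
  \<open>k = 0\<close> does no harm and one recurrence serves all \<open>k\<close>.\<close>

lemma gegen_Suc: "gegen d (Suc k) = pCons 0 (gegen d k) - smult (gegen_coeff d k) (gegen d (k - 1))"
  by (cases k) (auto simp: one_pCons)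

lemma poly_gegen_Suc:
  "poly (gegen d (Suc k)) t = t * poly (gegen d k) t - gegen_coeff d k * poly (gegen d (k - 1)) t"
  by (simp add: gegen_Suc)

text \<open>The relation between consecutive coefficients that closes the induction in
  \<open>gegen_deriv\<close>.\<close>

lemma gegen_coeff_step:
  assumes "d \<ge> 4"
  shows "1 + gegen_coeff d (Suc k) * (2 * real k + d - 2) = (2 * real k + d + 2) * gegen_coeff d (Suc (Suc k))"
proof -
  have "2 * real k + d - 2 > 0" "2 * real k + d > 0" "2 * real k + d + 2 > 0" using assms by auto
  then have e: "gegen_coeff d (Suc k) * (2 * real k + d - 2) = (real k + 1) * (real k + d - 2) / (2 * real k + d)"
    "(2 * real k + d + 2) * gegen_coeff d (Suc (Suc k)) = (real k + 2) * (real k + d - 1) / (2 * real k + d)"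
    by (auto simp: gegen_coeff_def divide_simps) (simp_all add: algebra_simps)
  show ?thesis unfolding e using \<open>2 * real k + d > 0\<close> by (simp add: divide_simps) (simp add: algebra_simps)
qed

text \<open>Lowering relation: the recurrence is differentiated and multiplied by
  \<open>1 - t^2\<close>, and the induction hypotheses for the two preceding degrees replace the
  derivatives.\<close>

lemma gegen_deriv:
  assumes "d \<ge> 4"
  shows "(1 - t\<^sup>2) * poly (pderiv (gegen d k)) t
    = (2 * real k + d - 2) * gegen_coeff d k * poly (gegen d (k - 1)) t - real k * t * poly (gegen d k) t"
  using assms
proof (induction d k rule: gegen.induct)
  case (2 d)
  then have "d * gegen_coeff d (Suc 0) = 1" by (simp add: gegen_coeff_def)
  then show ?case by (simp add: pderiv_pCons power2_eq_square)
next
  case (3 d k)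
  define l0 l1 l2 where "l0 = gegen_coeff d k" and "l1 = gegen_coeff d (Suc k)" and "l2 = gegen_coeff d (Suc (Suc k))"
  define p0 p1 p2 where "p0 = poly (gegen d (k - 1)) t" and "p1 = poly (gegen d k) t" and "p2 = poly (gegen d (Suc k)) t"
  define q1 q2 where "q1 = poly (pderiv (gegen d k)) t" and "q2 = poly (pderiv (gegen d (Suc k))) t"
  define K where "K = real k"
  have l: "1 + l1 * (2 * K + d - 2) = (2 * K + d + 2) * l2"
    using gegen_coeff_step[OF 3(3)] by (simp add: l1_def l2_def K_def)
  have IH: "(1 - t\<^sup>2) * q1 = (2 * K + d - 2) * l0 * p0 - K * t * p1"
    "(1 - t\<^sup>2) * q2 = (2 * K + d) * l1 * p1 - (K + 1) * t * p2"
    using 3 by (simp_all add: l0_def l1_def p0_def p1_def p2_def q1_def q2_def K_def algebra_simps)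
  have p: "l0 * p0 = t * p1 - p2"
    using poly_gegen_Suc[of d k t] by (simp add: l0_def p0_def p1_def p2_def)
  have "(1 - t\<^sup>2) * (p2 + t * q2 - l1 * q1) = (1 - t\<^sup>2) * p2 + t * ((1 - t\<^sup>2) * q2) - l1 * ((1 - t\<^sup>2) * q1)"
    by (simp add: algebra_simps)
  also have "\<dots> = (1 - t\<^sup>2) * p2 + t * ((2 * K + d) * l1 * p1 - (K + 1) * t * p2)
      - l1 * ((2 * K + d - 2) * (l0 * p0) - K * t * p1)" unfolding IH by (simp add: mult.assoc)
  also have "\<dots> = (1 + l1 * (2 * K + d - 2)) * p2 - (K + 2) * t * (t * p2 - l1 * p1)"
    unfolding p by (simp add: algebra_simps power2_eq_square)
  also have "\<dots> = (2 * K + d + 2) * l2 * p2 - (K + 2) * t * (t * p2 - l1 * p1)" unfolding l ..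
  finally show ?case
    by (simp add: pderiv_pCons pderiv_diff pderiv_smult l1_def l2_def p1_def p2_def q1_def q2_def K_def algebra_simps)
qed auto

lemma gegen_deriv_raise:
  assumes "d \<ge> 4"
  shows "(1 - t\<^sup>2) * poly (pderiv (gegen d k)) t
    = (real k + d - 2) * t * poly (gegen d k) t - (2 * real k + d - 2) * poly (gegen d (Suc k)) t"
  using gegen_deriv[OF assms, of t k] by (simp add: poly_gegen_Suc algebra_simps)

text \<open>Differentiating the lowering relation in degree \<open>k\<close> brings in the
  derivative of the polynomial of degree \<open>k - 1\<close>, which the raising relation
  eliminates.\<close>

lemma gegen_ode:
  assumes d: "d \<ge> 4"
  shows "(1 - t\<^sup>2) * poly (pderiv (pderiv (gegen d k))) t
    = (d - 1) * t * poly (pderiv (gegen d k)) t - real k * (real k + d - 2) * poly (gegen d k) t"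
proof (cases k)
  case (Suc j)
  define W where "W = [:1, 0, -1 :: real:]"
  have W: "poly W t = 1 - t\<^sup>2" for t by (simp add: W_def power2_eq_square)
  have pW: "poly (pderiv W) t = -2 * t" for t by (simp add: W_def pderiv_pCons)
  define P Q where "P = gegen d k" and "Q = gegen d j"
  define mu where "mu = (2 * real k + d - 2) * gegen_coeff d k"
  have mu: "mu * (2 * real j + d - 2) = real k * (real k + d - 3)"
    using d Suc by (simp add: mu_def gegen_coeff_def divide_simps)
  have P: "W * pderiv P = smult mu Q - smult (real k) (pCons 0 P)"
    unfolding poly_eq_poly_eq_iff[symmetric]
    using gegen_deriv[OF d, of _ k] Suc by (intro ext) (simp add: W P_def Q_def mu_def mult.assoc)
  have Q: "W * pderiv Q = smult (real j + d - 2) (pCons 0 Q) - smult (2 * real j + d - 2) P"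
    unfolding poly_eq_poly_eq_iff[symmetric]
    using gegen_deriv_raise[OF d, of _ j] Suc by (intro ext) (simp add: W P_def Q_def mult.assoc)
  \<comment> \<open>The elimination costs a second factor \<open>1 - t^2\<close>. The result is an
    identity of polynomials, so the nonzero \<open>W\<close> can be cancelled, which also covers
    \<open>t = 1\<close> and \<open>t = -1\<close>.\<close>
  have "poly (W * (W * pderiv (pderiv P))) t
      = poly (W * (smult (d - 1) (pCons 0 (pderiv P)) - smult (real k * (real k + d - 2)) P)) t" for t
  proof -
    define p p1 p2 q q1 w where "p = poly P t" and "p1 = poly (pderiv P) t" and "p2 = poly (pderiv (pderiv P)) t"
      and "q = poly Q t" and "q1 = poly (pderiv Q) t" and "w = 1 - t\<^sup>2"
    have "pderiv (W * pderiv P) = pderiv (smult mu Q - smult (real k) (pCons 0 P))" using P by simp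
    from arg_cong[OF this, of "\<lambda>p. poly p t"]
    have e1: "w * p2 - 2 * t * p1 = mu * q1 - real k * (p + t * p1)"
      by (simp add: pderiv_mult pderiv_diff pderiv_smult pderiv_pCons W pW p_def p1_def p2_def q1_def w_def algebra_simps)
    have e2: "w * p1 = mu * q - real k * t * p" and e3: "w * q1 = (real j + d - 2) * t * q - (2 * real j + d - 2) * p"
      using arg_cong[OF P, of "\<lambda>p. poly p t"] arg_cong[OF Q, of "\<lambda>p. poly p t"]
      by (simp_all add: W p_def p1_def q_def q1_def w_def mult.assoc)
    have "w * (w * p2) = w * (2 * t * p1 + mu * q1 - real k * (p + t * p1))" using e1 by simp
    also have "\<dots> = w * (2 * t * p1 - real k * (p + t * p1)) + mu * (w * q1)" by (simp add: algebra_simps)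
    also have "mu * (w * q1) = (real j + d - 2) * t * (mu * q) - mu * (2 * real j + d - 2) * p"
      unfolding e3 by (simp add: algebra_simps)
    also have "mu * q = w * p1 + real k * t * p" using e2 by simp
    also have "(real j + d - 2) * t * (w * p1 + real k * t * p) - mu * (2 * real j + d - 2) * p
        = w * ((real j + d - 2) * t * p1 - real k * (real k + d - 3) * p)"
      unfolding mu using Suc by (simp add: w_def algebra_simps power2_eq_square)
    finally show ?thesis using Suc
      by (simp add: W w_def p_def p1_def p2_def algebra_simps)
  qed
  then have "W * (W * pderiv (pderiv P)) 
      = W * (smult (d - 1) (pCons 0 (pderiv P)) - smult (real k * (real k + d - 2)) P)"
    by (simp add: poly_eq_poly_eq_iff[symmetric] ext)
  moreover have "W \<noteq> 0" by (simp add: W_def)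
  ultimately have "W * pderiv (pderiv P) = smult (d - 1) (pCons 0 (pderiv P)) - smult (real k * (real k + d - 2)) P"
    using mult_left_cancel by blast
  from arg_cong[OF this, of "\<lambda>p. poly p t"] show ?thesis
    by (simp add: W P_def mult.assoc)
qed auto

text \<open>Up to sign, these are the iterated partial derivatives of \<open>|x| powr (2 - n)\<close>, restricted to the sphere
  (Maxwell's multipoles); those of order \<open>k\<close> span the spherical harmonics of degree \<open>k\<close>.\<close>

primrec multipole :: "nat \<Rightarrow> nat list \<Rightarrow> poly_expr" where
  "multipole n [] = Const 1"
| "multipole n (i # I) = raise_op n (real n - 2 + real (length I)) i (multipole n I)"

definition multi_indices :: "nat \<Rightarrow> nat \<Rightarrow> nat list set" where
  "multi_indices n k = {I. set I \<subseteq> {..<n} \<and> length I = k}"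

lemma sum_multi_indices_Suc: "(\<Sum>I\<in>multi_indices n (Suc k). h I) = (\<Sum>i<n. \<Sum>I\<in>multi_indices n k. h (i # I))"
proof -
  have "(\<Sum>I\<in>multi_indices n (Suc k). h I) = (\<Sum>(i, I)\<in>{..<n} \<times> multi_indices n k. h (i # I))"
    by (rule sum.reindex_bij_witness[of _ "\<lambda>(i, I). i # I" "\<lambda>I. (hd I, tl I)"])
      (auto simp: multi_indices_def length_Suc_conv)
  then show ?thesis by (simp add: sum.cartesian_product)
qed

text \<open>Induction by \<open>zonal_raise\<close> with \<open>c = n - 2 + k\<close>: the
  differential equation removes the second derivative, the raising relation the first, and what is
  left is \<open>(2 k + n - 2)^2\<close> times the next Gegenbauer polynomial.\<close>

lemma gegen_addition_formula:
  assumes n: "n \<ge> 4" and x: "ipn n x x = 1" and y: "ipn n y y = 1"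
  shows "(\<Sum>I\<in>multi_indices n k. ev (multipole n I) x * ev (multipole n I) y)
    = (\<Prod>i<k. (2 * real i + real n - 2)\<^sup>2) * poly (gegen (real n) k) (ipn n x y)"
  using x y
proof (induction k arbitrary: x y)
  case 0
  have "multi_indices n 0 = {[]}" by (auto simp: multi_indices_def)
  then show ?case by simp
next
  case (Suc k)
  define B where "B = (\<Prod>i<k. (2 * real i + real n - 2)\<^sup>2)"
  define P where "P = gegen (real n) k"
  define c where "c = real n - 2 + real k"
  define t where "t = ipn n x y"
  define p p1 p2 p' where "p = poly P t" and "p1 = poly (pderiv P) t" and "p2 = poly (pderiv (pderiv P)) t"
    and "p' = poly (gegen (real n) (Suc k)) t"
  have d: "real n \<ge> 4" using n by simp
  have ker: "(\<Sum>I\<in>multi_indices n k. ev (multipole n I) x * ev (multipole n I) y) = poly (smult B P) (ipn n x y)"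
    if "ipn n x x = 1" "ipn n y y = 1" for x y
    using Suc.IH[OF that] by (simp add: B_def P_def)
  have "(\<Sum>I\<in>multi_indices n (Suc k). ev (multipole n I) x * ev (multipole n I) y)
      = (\<Sum>i<n. \<Sum>I\<in>multi_indices n k. ev (raise_op n c i (multipole n I)) x * ev (raise_op n c i (multipole n I)) y)"
    unfolding sum_multi_indices_Suc by (intro sum.cong refl) (auto simp: multi_indices_def c_def)
  also have "\<dots> = B * (c * t * (c * p + t * p1) - (1 - t\<^sup>2) * ((c + 1) * p1 + t * p2) - (c - real n + 1) * p1)"
    by (subst zonal_raise[OF ker Suc.prems])
      (simp_all add: pderiv_smult t_def p_def p1_def p2_def algebra_simps)
  also have "c * t * (c * p + t * p1) - (1 - t\<^sup>2) * ((c + 1) * p1 + t * p2) - (c - real n + 1) * p1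
      = c * c * t * p + (c - real n + 1) * (t\<^sup>2 - 1) * p1 + real n * t\<^sup>2 * p1 - t\<^sup>2 * p1 - (c + 1) * ((1 - t\<^sup>2) * p1) - t * ((1 - t\<^sup>2) * p2)"
    by (simp add: algebra_simps power2_eq_square)
  also have "(1 - t\<^sup>2) * p2 = (real n - 1) * t * p1 - real k * c * p"
    using gegen_ode[OF d, of t k] by (simp add: p1_def p2_def p_def P_def c_def algebra_simps)
  also have "c * c * t * p + (c - real n + 1) * (t\<^sup>2 - 1) * p1 + real n * t\<^sup>2 * p1 - t\<^sup>2 * p1 - (c + 1) * ((1 - t\<^sup>2) * p1)
      - t * ((real n - 1) * t * p1 - real k * c * p)
      = c * (c + real k) * t * p - (2 * real k + real n - 2) * ((1 - t\<^sup>2) * p1)"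
    by (simp add: c_def algebra_simps power2_eq_square)
  also have "(1 - t\<^sup>2) * p1 = c * t * p - (2 * real k + real n - 2) * p'"
    using gegen_deriv_raise[OF d, of t k] by (simp add: p1_def p'_def p_def P_def c_def algebra_simps)
  also have "c * (c + real k) * t * p - (2 * real k + real n - 2) * (c * t * p - (2 * real k + real n - 2) * p')
      = (2 * real k + real n - 2)\<^sup>2 * p'"
    by (simp add: c_def algebra_simps power2_eq_square)
  finally show ?case by (simp add: B_def p'_def t_def mult_ac)
qed

text \<open>By the addition formula the double sum is, up to the positive factor \<open>B\<close>, a
  sum of squares over multi-indices.\<close>

lemma gegen_positive_definite:
  assumes n: "n \<ge> 4" and X: "\<And>x. x \<in> X \<Longrightarrow> ipn n x x = 1"
  shows "(\<Sum>x\<in>X. \<Sum>y\<in>X. poly (gegen (real n) k) (ipn n x y)) \<ge> 0"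
proof -
  define B where "B = (\<Prod>i<k. (2 * real i + real n - 2)\<^sup>2)"
  have B: "B > 0" using n unfolding B_def by (intro prod_pos) auto
  have "B * (\<Sum>x\<in>X. \<Sum>y\<in>X. poly (gegen (real n) k) (ipn n x y))
      = (\<Sum>x\<in>X. \<Sum>y\<in>X. \<Sum>I\<in>multi_indices n k. ev (multipole n I) x * ev (multipole n I) y)"
    unfolding sum_distrib_left B_def
    by (intro sum.cong refl gegen_addition_formula[symmetric] n X)
  also have "\<dots> = (\<Sum>x\<in>X. \<Sum>I\<in>multi_indices n k. \<Sum>y\<in>X. ev (multipole n I) x * ev (multipole n I) y)"
    by (intro sum.cong refl sum.swap)
  also have "\<dots> = (\<Sum>I\<in>multi_indices n k. (\<Sum>x\<in>X. ev (multipole n I) x)\<^sup>2)"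
    unfolding power2_eq_square sum_product by (rule sum.swap)
  also have "\<dots> \<ge> 0" by (intro sum_nonneg) auto
  finally show ?thesis using B by (simp add: zero_le_mult_iff)
qed

section \<open>The linear programming bound\<close>

lemma gegen_coeff_eq:
  assumes "d \<ge> 4"
  shows "4 * gegen_coeff d (Suc k) = 1 - (d - 4) * (d - 2) / ((2 * real k + d - 2) * (2 * real k + d))"
proof -
  have "2 * real k + d - 2 > 0" "2 * real k + d > 0" using assms by auto
  moreover have "gegen_coeff d (Suc k) = (real k + 1) * (real k + d - 2) / ((2 * real k + d - 2) * (2 * real k + d))"
    by (simp add: gegen_coeff_def algebra_simps)
  ultimately show ?thesis by (simp add: divide_simps) (simp add: algebra_simps)
qed

lemma gegen_coeff_pos: "d \<ge> 4 \<Longrightarrow> gegen_coeff d (Suc k) > 0"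
  by (simp add: gegen_coeff_def)

lemma gegen_coeff_nonneg: "d \<ge> 4 \<Longrightarrow> gegen_coeff d k \<ge> 0"
  by (cases k) (auto intro: less_imp_le gegen_coeff_pos)

lemma gegen_coeff_mono:
  assumes d: "d \<ge> 4" and "i \<le> j"
  shows "gegen_coeff d i \<le> gegen_coeff d j"
proof (cases i)
  case 0
  then show ?thesis using gegen_coeff_nonneg[OF d] by simp
next
  case (Suc a)
  then obtain b where b: "j = Suc b" "a \<le> b" using \<open>i \<le> j\<close> by (cases j) auto
  have "(d - 4) * (d - 2) / ((2 * real b + d - 2) * (2 * real b + d))
      \<le> (d - 4) * (d - 2) / ((2 * real a + d - 2) * (2 * real a + d))"
    using d b by (intro divide_left_mono mult_mono mult_nonneg_nonneg mult_pos_pos) auto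
  then show ?thesis using gegen_coeff_eq[OF d, of a] gegen_coeff_eq[OF d, of b] b Suc by simp
qed

text \<open>The subtracted term of \<open>gegen_coeff_eq\<close> is a product of two fractions, each
  at most \<open>1 / (1 + 2 * \<rho>)\<close>. From degree \<open>\<rho> * d\<close> on this bounds
  the entries of the multiplication operator below.\<close>

lemma gegen_coeff_lower:
  assumes d: "d \<ge> 4" and r: "\<rho> > 0" "\<rho> * d \<le> real k"
  shows "1 - 1 / (1 + 2 * \<rho>)\<^sup>2 \<le> 4 * gegen_coeff d k"
proof -
  have "\<rho> * d > 0" using d r by simp
  then have "k \<noteq> 0" using r by (intro notI) simp
  then obtain a where a: "k = Suc a" by (cases k) auto
  have b: "x / (2 * real k + x) \<le> 1 / (1 + 2 * \<rho>)" if "x \<ge> 0" "x \<le> d" for x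
  proof -
    have "\<rho> * x \<le> real k" using r that mult_left_mono[of x d \<rho>] by linarith
    then have "x * (1 + 2 * \<rho>) \<le> 2 * real k + x" by (simp add: algebra_simps)
    moreover have "2 * real k + x > 0" using that a by simp
    ultimately show ?thesis using r by (simp add: divide_simps)
  qed
  have "(d - 4) / (2 * real k + (d - 4)) * ((d - 2) / (2 * real k + (d - 2))) \<le> 1 / (1 + 2 * \<rho>) * (1 / (1 + 2 * \<rho>))"
    using d r a by (intro mult_mono b) auto
  then show ?thesis unfolding a gegen_coeff_eq[OF d] by (simp add: power2_eq_square algebra_simps)
qed

text \<open>The squared norm of the monic polynomial \<open>gegen d k\<close> when the orthogonality
  measure has total mass 1.\<close>

definition gegen_norm2 :: "real \<Rightarrow> nat \<Rightarrow> real" where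
  "gegen_norm2 d k = (\<Prod>i<k. gegen_coeff d (Suc i))"

lemma gegen_norm2_0 [simp]: "gegen_norm2 d 0 = 1"
  by (simp add: gegen_norm2_def)

lemma gegen_norm2_Suc: "gegen_norm2 d (Suc k) = gegen_norm2 d k * gegen_coeff d (Suc k)"
  by (simp add: gegen_norm2_def)

lemma gegen_norm2_pos: "d \<ge> 4 \<Longrightarrow> gegen_norm2 d k > 0"
  unfolding gegen_norm2_def by (intro prod_pos) (auto intro: gegen_coeff_pos)

text \<open>Askey's argument: for a monic three-term recurrence with nondecreasing coefficients,
  \<open>P\<^bsub>i+1\<^esub> P\<^sub>j - P\<^sub>i P\<^bsub>j+1\<^esub>\<close> satisfies a recursion in \<open>i\<close> with nonnegative coefficients.\<close>

lemma gegen_linearization: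
  fixes \<Phi> :: "real poly \<Rightarrow> real"
  assumes d: "d \<ge> 4"
    and add: "\<And>p q. \<Phi> (p + q) = \<Phi> p + \<Phi> q" and scale: "\<And>a p. \<Phi> (smult a p) = a * \<Phi> p"
    and nonneg: "\<And>k. \<Phi> (gegen d k) \<ge> 0"
    and "i \<le> j"
  shows "\<Phi> (gegen d i * gegen d j) \<ge> (if i = j then gegen_norm2 d i * \<Phi> 1 else 0)
    \<and> \<Phi> (gegen d (Suc i) * gegen d j - gegen d i * gegen d (Suc j))
      \<ge> (if j = Suc i then gegen_norm2 d j * \<Phi> 1 else 0)"
  using \<open>i \<le> j\<close>
proof (induction i arbitrary: j)
  case 0
  have "\<Phi> (gegen d (Suc 0) * gegen d j - gegen d 0 * gegen d (Suc j)) = gegen_coeff d j * \<Phi> (gegen d (j - 1))"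
    by (simp add: gegen_Suc[of d j] scale)
  moreover have "\<dots> \<ge> (if j = Suc 0 then gegen_norm2 d j * \<Phi> 1 else 0)"
    using nonneg gegen_coeff_nonneg[OF d] by (auto simp: gegen_norm2_Suc)
  ultimately show ?case using nonneg[of j] by auto
next
  case (Suc i)
  have A: "\<Phi> (gegen d (Suc i) * gegen d j) \<ge> (if Suc i = j then gegen_norm2 d (Suc i) * \<Phi> 1 else 0)"
    if "Suc i \<le> j" for j
  proof -
    have "\<Phi> (gegen d (Suc i) * gegen d j) = \<Phi> (gegen d i * gegen d (Suc j))
        + \<Phi> (gegen d (Suc i) * gegen d j - gegen d i * gegen d (Suc j))"
      unfolding add[symmetric] by simp
    then show ?thesis using Suc.IH[of "Suc j"] Suc.IH[of j] that by auto
  qed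
  obtain j' where j': "j = Suc j'" using Suc.prems by (cases j) auto
  \<comment> \<open>Both factors of higher degree are expanded by the recurrence; the terms with a
    factor \<open>t\<close> cancel.\<close>
  have "gegen d (Suc (Suc i)) * gegen d j - gegen d (Suc i) * gegen d (Suc j)
    = smult (gegen_coeff d j - gegen_coeff d (Suc i)) (gegen d (Suc i) * gegen d j')
      + smult (gegen_coeff d (Suc i)) (gegen d (Suc i) * gegen d j' - gegen d i * gegen d (Suc j'))"
    unfolding gegen_Suc[of d "Suc i"] gegen_Suc[of d j] using j'
    by (simp add: algebra_simps smult_diff_left smult_diff_right)
  then have eq: "\<Phi> (gegen d (Suc (Suc i)) * gegen d j - gegen d (Suc i) * gegen d (Suc j))
    = (gegen_coeff d j - gegen_coeff d (Suc i)) * \<Phi> (gegen d (Suc i) * gegen d j')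
      + gegen_coeff d (Suc i) * \<Phi> (gegen d (Suc i) * gegen d j' - gegen d i * gegen d (Suc j'))"
    by (simp add: add scale)
  have mono: "gegen_coeff d j - gegen_coeff d (Suc i) \<ge> 0" using gegen_coeff_mono[OF d Suc.prems] by simp
  note nn = gegen_coeff_nonneg[OF d, of "Suc i"]
  have "\<Phi> (gegen d (Suc (Suc i)) * gegen d j - gegen d (Suc i) * gegen d (Suc j))
      \<ge> (if j = Suc (Suc i) then gegen_norm2 d j * \<Phi> 1 else 0)"
  \<comment> \<open>For \<open>j = Suc i\<close> the first product lies outside the range of
    \<open>A\<close>, but its coefficient vanishes.\<close>
  proof (cases "j = Suc i")
    case True
    then have "\<Phi> (gegen d (Suc (Suc i)) * gegen d j - gegen d (Suc i) * gegen d (Suc j))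
      = gegen_coeff d (Suc i) * \<Phi> (gegen d (Suc i) * gegen d j' - gegen d i * gegen d (Suc j'))"
      using eq by simp
    also have "\<dots> \<ge> 0" using Suc.IH[of j'] True j' nn by (auto intro!: mult_nonneg_nonneg)
    finally show ?thesis using True by simp
  next
    case False
    then have le: "Suc i \<le> j'" using Suc.prems j' by simp
    have "(gegen_coeff d j - gegen_coeff d (Suc i)) * \<Phi> (gegen d (Suc i) * gegen d j')
       + gegen_coeff d (Suc i) * \<Phi> (gegen d (Suc i) * gegen d j' - gegen d i * gegen d (Suc j'))
       \<ge> (gegen_coeff d j - gegen_coeff d (Suc i)) * (if Suc i = j' then gegen_norm2 d (Suc i) * \<Phi> 1 else 0)
        + gegen_coeff d (Suc i) * (if j' = Suc i then gegen_norm2 d j' * \<Phi> 1 else 0)"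
      using le by (intro add_mono mult_left_mono A conjunct2[OF Suc.IH] mono nn) auto
    \<comment> \<open>If \<open>j' = Suc i\<close>, the two lower bounds add up to
      \<open>gegen_coeff d j * gegen_norm2 d j'\<close> times \<open>\<Phi> 1\<close>, which
      contains the next squared norm.\<close>
    moreover have "(gegen_coeff d j - gegen_coeff d (Suc i)) * (if Suc i = j' then gegen_norm2 d (Suc i) * \<Phi> 1 else 0)
        + gegen_coeff d (Suc i) * (if j' = Suc i then gegen_norm2 d j' * \<Phi> 1 else 0)
        = (if j = Suc (Suc i) then gegen_norm2 d j * \<Phi> 1 else 0)"
      using j' by (auto simp: gegen_norm2_Suc[of d "Suc i"] algebra_simps)
    ultimately show ?thesis unfolding eq by simp
  qed
  with A[OF Suc.prems] show ?case by blast
qed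

definition gegen_on :: "real \<Rightarrow> nat \<Rightarrow> real poly" where
  "gegen_on d k = smult (1 / sqrt (gegen_norm2 d k)) (gegen d k)"

text \<open>In the orthonormal scaling, multiplication by \<open>t\<close> becomes a symmetric
  tridiagonal matrix whose off-diagonal entries are the roots of the recurrence
  coefficients.\<close>

lemma gegen_on_mult_X:
  assumes "d \<ge> 4"
  shows "pCons 0 (gegen_on d k) = smult (sqrt (gegen_coeff d (Suc k))) (gegen_on d (Suc k))
    + smult (sqrt (gegen_coeff d k)) (gegen_on d (k - 1))"
proof -
  have "pCons 0 (gegen d k) = gegen d (Suc k) + smult (gegen_coeff d k) (gegen d (k - 1))"
    by (simp add: gegen_Suc)
  then have "pCons 0 (gegen_on d k) = smult (1 / sqrt (gegen_norm2 d k)) (gegen d (Suc k))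
     + smult (gegen_coeff d k / sqrt (gegen_norm2 d k)) (gegen d (k - 1))"
    by (metis (no_types, lifting) gegen_on_def smult_add_right smult_pCons mult_zero_right smult_smult times_divide_eq_left mult_1)
  moreover have "1 / sqrt (gegen_norm2 d k) = sqrt (gegen_coeff d (Suc k)) * (1 / sqrt (gegen_norm2 d (Suc k)))"
    using gegen_coeff_pos[OF assms, of k] by (simp add: gegen_norm2_Suc real_sqrt_mult)
  moreover have "gegen_coeff d k / sqrt (gegen_norm2 d k) = sqrt (gegen_coeff d k) * (1 / sqrt (gegen_norm2 d (k - 1)))"
    using gegen_coeff_pos[OF assms] 
    by (cases k) (simp_all add: gegen_norm2_Suc real_sqrt_mult real_div_sqrt divide_simps less_imp_le)
  ultimately show ?thesis by (simp add: gegen_on_def)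
qed

text \<open>Testing with all functionals that are nonnegative on the \<open>gegen d k\<close>
  encodes that products have nonnegative expansions, without writing the expansions down; for
  \<open>i = j\<close> it also records the constant term 1.\<close>

lemma gegen_on_linearization:
  fixes \<Phi> :: "real poly \<Rightarrow> real"
  assumes d: "d \<ge> 4"
    and add: "\<And>p q. \<Phi> (p + q) = \<Phi> p + \<Phi> q" and scale: "\<And>a p. \<Phi> (smult a p) = a * \<Phi> p"
    and nonneg: "\<And>k. \<Phi> (gegen d k) \<ge> 0"
  shows "\<Phi> (gegen_on d i * gegen_on d j) \<ge> (if i = j then \<Phi> 1 else 0)"
proof -
  have *: "\<Phi> (gegen_on d i * gegen_on d j) \<ge> (if i = j then \<Phi> 1 else 0)" if "i \<le> j" for i j
  proof -
    define a where "a = 1 / (sqrt (gegen_norm2 d i) * sqrt (gegen_norm2 d j))"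
    have a: "a \<ge> 0" using gegen_norm2_pos[OF d] by (simp add: a_def less_imp_le)
    have "\<Phi> (gegen_on d i * gegen_on d j) = a * \<Phi> (gegen d i * gegen d j)"
      by (simp add: gegen_on_def scale a_def mult.commute)
    also have "\<dots> \<ge> a * (if i = j then gegen_norm2 d i * \<Phi> 1 else 0)"
      by (intro mult_left_mono a conjunct1[OF gegen_linearization[OF d add scale nonneg that]])
    also have "a * (if i = j then gegen_norm2 d i * \<Phi> 1 else 0) = (if i = j then \<Phi> 1 else 0)"
      using gegen_norm2_pos[OF d, of j] by (auto simp: a_def)
    finally show ?thesis .
  qed
  show ?thesis using *[of i j] *[of j i] by (cases "i \<le> j") (auto simp: mult.commute)
qed

text \<open>The sum \<open>\<Phi>\<close> of \<open>(t - \<tau>) f^2\<close> over all pairs is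
  bounded twice. From below, the linearization keeps the products with \<open>i = j\<close>, each
  worth at least \<open>\<Phi> 1 = (card X)^2\<close>. From above, only the pairs
  \<open>x = y\<close> remain, since the others contribute at most 0. Cauchy-Schwarz for
  \<open>f\<close> at 1 then cancels the squared norm \<open>S\<close> of the weights.\<close>

lemma spherical_code_lp_bound:
  assumes n: "n \<ge> 4" and fin: "finite X" and unit: "\<And>x. x \<in> X \<Longrightarrow> ipn n x x = 1"
    and sep: "\<And>x y. x \<in> X \<Longrightarrow> y \<in> X \<Longrightarrow> x \<noteq> y \<Longrightarrow> ipn n x y \<le> \<tau>" and tau: "\<tau> \<le> 1"
    and W: "\<And>i. W i \<ge> 0" "\<And>i. i \<ge> K \<Longrightarrow> W i = 0" "W i0 > 0"
    and eta: "\<eta> > 0"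
    and V: "\<And>i. sqrt (gegen_coeff (real n) i) * W (i - 1) + sqrt (gegen_coeff (real n) (Suc i)) * W (Suc i)
       - \<tau> * W i \<ge> \<eta> * W i"
  shows "\<eta> * real (card X) \<le> (1 - \<tau>) * (\<Sum>i\<in>{i. i < K \<and> W i \<noteq> 0}. (poly (gegen_on (real n) i) 1)\<^sup>2)"
proof -
  define d where "d = real n"
  have d: "d \<ge> 4" using n by (simp add: d_def)
  define \<Phi> where "\<Phi> p = (\<Sum>x\<in>X. \<Sum>y\<in>X. poly p (ipn n x y))" for p
  have add: "\<Phi> (p + q) = \<Phi> p + \<Phi> q" for p q by (simp add: \<Phi>_def sum.distrib)
  have scale: "\<Phi> (smult a p) = a * \<Phi> p" for a p by (simp add: \<Phi>_def sum_distrib_left)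
  have nonneg: "\<Phi> (gegen d k) \<ge> 0" for k
    unfolding \<Phi>_def d_def by (intro gegen_positive_definite n unit)
  have one: "\<Phi> 1 = (real (card X))\<^sup>2" by (simp add: \<Phi>_def power2_eq_square)
  have zero: "\<Phi> 0 = 0" by (simp add: \<Phi>_def)
  have sum: "\<Phi> (\<Sum>i\<in>A. h i) = (\<Sum>i\<in>A. \<Phi> (h i))" if "finite A" for A :: "nat set" and h
    using that by (induction A rule: finite_induct) (auto simp: add zero)
  define V' where "V' i = sqrt (gegen_coeff d i) * W (i - 1) + sqrt (gegen_coeff d (Suc i)) * W (Suc i) - \<tau> * W i" for i
  have V': "V' i \<ge> \<eta> * W i" for i using V by (simp add: V'_def d_def)
  define S where "S = (\<Sum>i\<le>K. (W i)\<^sup>2)"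
  have "i0 \<le> K" using W(2)[of i0] W(3) by (cases "i0 \<le> K") auto
  then have "S \<ge> (W i0)\<^sup>2" unfolding S_def by (intro member_le_sum) auto
  then have S: "S > 0" using W(3) by (smt (verit) zero_less_power)
  define f where "f = (\<Sum>i\<le>K. smult (W i) (gegen_on d i))"
  have Xf: "pCons 0 f - smult \<tau> f = (\<Sum>i\<le>K. smult (V' i) (gegen_on d i))"
  proof -
    have pc: "pCons 0 (\<Sum>i\<in>A. h i) = (\<Sum>i\<in>A. pCons 0 (h i))" if "finite A" for A :: "nat set" and h :: "nat \<Rightarrow> real poly"
      using that
    proof (induction A rule: finite_induct)
      case (insert i A)
      have "pCons 0 (h i + sum h A) = pCons 0 (h i) + pCons 0 (sum h A)" by (simp only: add_pCons add_0)
      then show ?case by (simp only: sum.insert[OF insert.hyps] insert.IH)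
    qed simp
    have sm: "smult \<tau> (\<Sum>i\<in>A. h i) = (\<Sum>i\<in>A. smult \<tau> (h i))" if "finite A" for A :: "nat set" and h
      using that by (induction A rule: finite_induct) (auto simp: smult_add_right)
    have "pCons 0 f = (\<Sum>i\<le>K. smult (W i) (pCons 0 (gegen_on d i)))"
      by (simp add: f_def pc)
    also have "\<dots> = (\<Sum>i\<le>K. smult (W i * sqrt (gegen_coeff d (Suc i))) (gegen_on d (Suc i)))
        + (\<Sum>i\<le>K. smult (W i * sqrt (gegen_coeff d i)) (gegen_on d (i - 1)))"
      by (simp add: gegen_on_mult_X[OF d] smult_add_right sum.distrib)
    \<comment> \<open>Both sums are shifted to collect the coefficient of
      \<open>gegen_on d i\<close>; the boundary terms vanish because \<open>W\<close> is 0 from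
      \<open>K\<close> on and \<open>gegen_coeff d 0 = 0\<close>.\<close>
    also have "(\<Sum>i\<le>K. smult (W i * sqrt (gegen_coeff d (Suc i))) (gegen_on d (Suc i)))
        = (\<Sum>i\<le>Suc K. smult (W (i - 1) * sqrt (gegen_coeff d i)) (gegen_on d i))"
      by (subst sum.atMost_Suc_shift) simp
    also have "\<dots> = (\<Sum>i\<le>K. smult (W (i - 1) * sqrt (gegen_coeff d i)) (gegen_on d i))"
      using W(2)[of K] by simp
    also have "(\<Sum>i\<le>K. smult (W i * sqrt (gegen_coeff d i)) (gegen_on d (i - 1)))
        = (\<Sum>i\<le>Suc K. smult (W i * sqrt (gegen_coeff d i)) (gegen_on d (i - 1)))"
      using W(2)[of "Suc K"] by simp
    also have "\<dots> = (\<Sum>i\<le>K. smult (W (Suc i) * sqrt (gegen_coeff d (Suc i))) (gegen_on d i))"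
      by (subst sum.atMost_Suc_shift) simp
    finally show ?thesis
      by (simp add: f_def V'_def sm sum.distrib[symmetric] sum_subtractf[symmetric] smult_add_left[symmetric] smult_diff_left[symmetric] mult.commute)
  qed
  have "\<Phi> ((pCons 0 f - smult \<tau> f) * f) = (\<Sum>i\<le>K. \<Sum>j\<le>K. V' i * W j * \<Phi> (gegen_on d i * gegen_on d j))"
    unfolding Xf unfolding f_def sum_product by (simp add: sum scale mult_ac)
  also have "\<dots> \<ge> (\<Sum>i\<le>K. \<Sum>j\<le>K. V' i * W j * (if i = j then \<Phi> 1 else 0))"
  proof (intro sum_mono mult_left_mono gegen_on_linearization[OF d add scale nonneg] mult_nonneg_nonneg W(1))
    show "V' i \<ge> 0" for i using V'[of i] mult_nonneg_nonneg[of \<eta> "W i"] eta W(1)[of i] by linarith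
  qed
  also have "(\<Sum>i\<le>K. \<Sum>j\<le>K. V' i * W j * (if i = j then \<Phi> 1 else 0)) = (\<Sum>i\<le>K. V' i * W i) * \<Phi> 1"
    by (simp add: sum_distrib_right if_distrib[of "\<lambda>x. _ * x"] cong: if_cong)
  also have "\<dots> \<ge> (\<Sum>i\<le>K. \<eta> * W i * W i) * \<Phi> 1"
    by (intro mult_right_mono sum_mono V' W) (simp add: one)
  also have "(\<Sum>i\<le>K. \<eta> * W i * W i) * \<Phi> 1 = \<eta> * S * (real (card X))\<^sup>2"
    by (simp add: S_def sum_distrib_left one power2_eq_square mult.assoc)
  finally have lower: "\<eta> * S * (real (card X))\<^sup>2 \<le> \<Phi> ((pCons 0 f - smult \<tau> f) * f)" .
  have "\<Phi> ((pCons 0 f - smult \<tau> f) * f) \<le> (\<Sum>x\<in>X. \<Sum>y\<in>X. if x = y then (1 - \<tau>) * (poly f 1)\<^sup>2 else 0)"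
    unfolding \<Phi>_def
  proof (intro sum_mono)
    fix x y assume xy: "x \<in> X" "y \<in> X"
    have "poly ((pCons 0 f - smult \<tau> f) * f) z = (z - \<tau>) * (poly f z)\<^sup>2" for z
      by (simp add: power2_eq_square algebra_simps)
    moreover have "(ipn n x y - \<tau>) * (poly f (ipn n x y))\<^sup>2 \<le> 0" if "x \<noteq> y"
      using sep[OF xy that] by (intro mult_nonpos_nonneg) auto
    ultimately show "poly ((pCons 0 f - smult \<tau> f) * f) (ipn n x y) \<le> (if x = y then (1 - \<tau>) * (poly f 1)\<^sup>2 else 0)"
      using unit[OF xy(1)] by auto
  qed
  also have "\<dots> = real (card X) * ((1 - \<tau>) * (poly f 1)\<^sup>2)" using fin by simp
  finally have upper: "\<eta> * S * (real (card X))\<^sup>2 \<le> real (card X) * ((1 - \<tau>) * (poly f 1)\<^sup>2)" using lower by linarith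
  define I where "I = {i. i < K \<and> W i \<noteq> 0}"
  define D where "D = (\<Sum>i\<in>I. (poly (gegen_on d i) 1)\<^sup>2)"
  have I: "finite I" "I \<subseteq> {..K}" "\<And>i. i \<in> {..K} - I \<Longrightarrow> W i = 0" using W(2) by (auto simp: I_def not_less)
  have "poly f 1 = (\<Sum>i\<in>I. W i * poly (gegen_on d i) 1)"
    unfolding f_def poly_sum using I by (intro sum.mono_neutral_cong_right) auto
  then have "(poly f 1)\<^sup>2 \<le> (\<Sum>i\<in>I. (W i)\<^sup>2) * D"
    unfolding D_def using Cauchy_Schwarz_ineq_sum[of W "\<lambda>i. poly (gegen_on d i) 1" I] by simp
  also have "(\<Sum>i\<in>I. (W i)\<^sup>2) = S"
    unfolding S_def using I by (intro sum.mono_neutral_left) auto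
  finally have f1: "(1 - \<tau>) * (poly f 1)\<^sup>2 \<le> (1 - \<tau>) * (S * D)" using tau by (intro mult_left_mono) auto
  show ?thesis
  proof (cases "card X = 0")
    case True
    then show ?thesis using tau by (auto intro!: mult_nonneg_nonneg sum_nonneg)
  next
    case False
    then have "\<eta> * S * real (card X) \<le> (1 - \<tau>) * (poly f 1)\<^sup>2"
      using upper by (simp add: power2_eq_square mult.assoc mult.left_commute[of _ "real (card X)"])
    also note f1
    finally have "S * (\<eta> * real (card X)) \<le> S * ((1 - \<tau>) * D)" by (simp add: mult_ac)
    then show ?thesis using S by (simp add: D_def I_def d_def)
  qed
qed

section \<open>The Kabatiansky-Levenshtein bound\<close>

lemma gegen_at_one:
  assumes "d \<ge> 4"
  shows "(2 * real k + d - 2) * poly (gegen d (Suc k)) 1 = (real k + d - 2) * poly (gegen d k) 1"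
  using gegen_deriv_raise[OF assms, of 1 k] by simp

text \<open>The squared value at 1 is the dimension of the space of spherical harmonics of degree
  \<open>k\<close>; the induction compares the ratio of consecutive values with that of the binomial
  coefficients.\<close>

lemma gegen_on_at_one:
  assumes n: "n \<ge> 4"
  shows "(real n - 2) * (poly (gegen_on (real n) k) 1)\<^sup>2 = (2 * real k + real n - 2) * real ((k + n - 3) choose k)"
proof (induction k)
  case 0
  then show ?case by (simp add: gegen_on_def)
next
  case (Suc k)
  define d where "d = real n"
  define m where "m = k + n - 3"
  have d: "d \<ge> 4" using n by (simp add: d_def)
  have m: "real (Suc m) = real k + d - 2" "Suc k + n - 3 = Suc m" using n by (auto simp: m_def d_def)
  define P P' where "P = poly (gegen d k) 1" and "P' = poly (gegen d (Suc k)) 1"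
  define N where "N = gegen_norm2 d k"
  define l where "l = gegen_coeff d (Suc k)"
  have N: "N > 0" unfolding N_def by (rule gegen_norm2_pos[OF d])
  have l: "l > 0" unfolding l_def by (rule gegen_coeff_pos[OF d])
  define u v where "u = 2 * real k + d - 2" and "v = real k + d - 2"
  have uv: "u > 0" "v > 0" using d by (auto simp: u_def v_def)
  have P': "P' = v / u * P"
    using gegen_at_one[OF d, of k] uv by (simp add: P_def P'_def u_def v_def field_simps)
  have l': "l = (real k + 1) * v / (u * (2 * real k + d))"
    by (simp add: l_def gegen_coeff_def u_def v_def algebra_simps)
  have sq: "(poly (gegen_on d k) 1)\<^sup>2 = P\<^sup>2 / N" "(poly (gegen_on d (Suc k)) 1)\<^sup>2 = P'\<^sup>2 / (N * l)"
    using N l by (simp_all add: gegen_on_def gegen_norm2_Suc P_def P'_def N_def l_def power_divide)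
  have "P'\<^sup>2 / (N * l) = P\<^sup>2 / N * (v * (2 * real k + d) / (u * (real k + 1)))"
  proof -
    have "(v / u * P)\<^sup>2 / (N * (e * v / (u * q))) = P\<^sup>2 / N * (v * q / (u * e))" if "q > 0" "e > 0" for q e
      using uv N that by (simp add: power2_eq_square divide_simps)
    then show ?thesis unfolding P' l' using d by simp
  qed
  then have "(d - 2) * (P'\<^sup>2 / (N * l)) = (d - 2) * (P\<^sup>2 / N) * (v * (2 * real k + d) / (u * (real k + 1)))"
    by simp
  also have "(d - 2) * (P\<^sup>2 / N) = u * real (m choose k)"
    using Suc by (simp add: sq d_def[symmetric] m_def u_def)
  also have "u * real (m choose k) * (v * (2 * real k + d) / (u * (real k + 1)))
      = (2 * real k + d) * (v * real (m choose k) / (real k + 1))"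
  proof -
    have "u * M * (v * q / (u * e)) = q * (v * M / e)" for M q e :: real using uv by simp
    then show ?thesis .
  qed
  also have "v * real (m choose k) = real (Suc m choose Suc k) * (real k + 1)"
  proof -
    have "v = real (Suc m)" using m(1) by (simp add: v_def)
    then show ?thesis
      using arg_cong[OF Suc_times_binomial_eq[of m k], of real] by (simp only: of_nat_mult) simp
  qed
  also have "real (Suc m choose Suc k) * (real k + 1) / (real k + 1) = real (Suc m choose Suc k)"
  proof -
    have "real k + 1 \<noteq> 0" by linarith
    then show ?thesis by simp
  qed
  finally show ?case unfolding m(2) d_def[symmetric] sq by (simp del: binomial_Suc_Suc add: algebra_simps)
qed

text \<open>One term of the binomial expansion of \<open>(1 + \<rho>) ^ (k + m)\<close> is at most
  the whole sum. For \<open>k\<close> close to \<open>\<rho> * m\<close> this has the correct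
  exponential rate.\<close>

lemma binomial_le_powers:
  fixes \<rho> :: real
  assumes "\<rho> > 0"
  shows "real ((k + m) choose k) \<le> (1 + 1 / \<rho>) ^ k * (1 + \<rho>) ^ m"
proof -
  have "real ((k + m) choose k) * \<rho> ^ k \<le> (\<Sum>i\<le>k + m. real ((k + m) choose i) * \<rho> ^ i)"
    using assms by (intro member_le_sum) auto
  also have "\<dots> = (1 + \<rho>) ^ (k + m)"
    using binomial_ring[of \<rho> 1 "k + m"] by (simp add: add.commute)
  also have "\<dots> = ((1 + 1 / \<rho>) ^ k * (1 + \<rho>) ^ m) * \<rho> ^ k"
    using assms by (simp add: power_add power_mult_distrib[symmetric] algebra_simps)
  finally show ?thesis using assms by simp
qed

text \<open>This is \<open>1 + \<rho>\<close> times the entropy of the probabilities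
  \<open>\<rho> / (1 + \<rho>)\<close> and \<open>1 / (1 + \<rho>)\<close>.\<close>

definition kl_rate :: "real \<Rightarrow> real" where
  "kl_rate \<rho> = (1 + \<rho>) * ln (1 + \<rho>) - \<rho> * ln \<rho>"

text \<open>Exceeding the degree \<open>\<rho> * n\<close> by a bounded amount \<open>R\<close>
  costs only a factor independent of \<open>n\<close>.\<close>

lemma gegen_on_at_one_le:
  assumes n: "n \<ge> 4" and r: "\<rho> > 0" and k: "real k \<le> \<rho> * real n + R" and R: "R \<ge> 0"
  shows "(poly (gegen_on (real n) k) 1)\<^sup>2 \<le> (4 * \<rho> + 4 * R + 2) * exp (R * ln (1 + 1 / \<rho>)) * exp (real n * kl_rate \<rho>)"
proof -
  have "2 * real k + real n - 2 \<le> (4 * \<rho> + 4 * R + 2) * (real n - 2)"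
  proof -
    have "2 * real k + real n - 2 \<le> 2 * (\<rho> * real n) + 2 * R + real n - 2" using k by simp
    also have "\<dots> \<le> (4 * \<rho> + 4 * R + 2) * (real n - 2)"
    proof -
      have "\<rho> * 4 \<le> \<rho> * real n" "R * 4 \<le> R * real n" using n r R by (auto intro!: mult_left_mono)
      then show ?thesis using n R by (simp add: algebra_simps)
    qed
    finally show ?thesis .
  qed
  then have a: "(2 * real k + real n - 2) / (real n - 2) \<le> 4 * \<rho> + 4 * R + 2"
    using n by (simp add: divide_simps)
  have "k + n - 3 = k + (n - 3)" using n by simp
  then have "real ((k + n - 3) choose k) \<le> (1 + 1 / \<rho>) ^ k * (1 + \<rho>) ^ (n - 3)"
    using binomial_le_powers[OF r, of k "n - 3"] by simp
  also have "\<dots> \<le> exp (real k * ln (1 + 1 / \<rho>)) * exp (real n * ln (1 + \<rho>))"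
  proof (intro mult_mono)
    show "(1 + 1 / \<rho>) ^ k \<le> exp (real k * ln (1 + 1 / \<rho>))" using r by (simp add: exp_of_nat_mult add_pos_pos)
    have "(1 + \<rho>) ^ (n - 3) \<le> (1 + \<rho>) ^ n" using r by (intro power_increasing) auto
    then show "(1 + \<rho>) ^ (n - 3) \<le> exp (real n * ln (1 + \<rho>))" using r by (simp add: exp_of_nat_mult)
  qed (use r in auto)
  also have "\<dots> \<le> exp ((\<rho> * real n + R) * ln (1 + 1 / \<rho>)) * exp (real n * ln (1 + \<rho>))"
    using k r by (intro mult_right_mono iffD2[OF exp_le_cancel_iff]) auto
  also have "\<dots> = exp (R * ln (1 + 1 / \<rho>)) * exp (real n * kl_rate \<rho>)"
  proof -
    have "1 + 1 / \<rho> = (1 + \<rho>) / \<rho>" using r by (simp add: field_simps)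
    then have l: "ln (1 + 1 / \<rho>) = ln (1 + \<rho>) - ln \<rho>" using r by (simp add: ln_div)
    show ?thesis unfolding exp_add[symmetric] l kl_rate_def by (simp add: algebra_simps)
  qed
  finally have b: "real ((k + n - 3) choose k) \<le> exp (R * ln (1 + 1 / \<rho>)) * exp (real n * kl_rate \<rho>)" .
  have "(poly (gegen_on (real n) k) 1)\<^sup>2 = (2 * real k + real n - 2) / (real n - 2) * real ((k + n - 3) choose k)"
    using gegen_on_at_one[OF n, of k] n by (simp add: field_simps)
  also have "\<dots> \<le> (4 * \<rho> + 4 * R + 2) * (exp (R * ln (1 + 1 / \<rho>)) * exp (real n * kl_rate \<rho>))"
    using a b r R by (intro mult_mono) auto
  finally show ?thesis by simp
qed

text \<open>The strict inequality leaves a gap \<open>\<sigma> - \<tau>\<close> that pays for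
  truncating to a window whose length is independent of \<open>n\<close>; therefore \<open>K\<close>
  depends on \<open>\<rho>\<close> and \<open>\<tau>\<close> only.\<close>

theorem kabatiansky_levenshtein:
  assumes r: "\<rho> > 0" and tau: "\<tau> < sqrt (1 - 1 / (1 + 2 * \<rho>)\<^sup>2)"
  shows "\<exists>K\<ge>1. \<forall>n X. n \<ge> 4 \<longrightarrow> finite X \<longrightarrow> (\<forall>x\<in>X. ipn n x x = 1) \<longrightarrow>
      (\<forall>x\<in>X. \<forall>y\<in>X. x \<noteq> y \<longrightarrow> ipn n x y \<le> \<tau>) \<longrightarrow>
      real (card X) \<le> K * exp (real n * kl_rate \<rho>)"
proof -
  define \<sigma> where "\<sigma> = sqrt (1 - 1 / (1 + 2 * \<rho>)\<^sup>2)"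
  have "1 / (1 + 2 * \<rho>)\<^sup>2 \<le> 1" "1 / (1 + 2 * \<rho>)\<^sup>2 > 0" using r by (auto simp: power2_eq_square divide_simps add_pos_pos intro: mult_ge1_I)
  then have \<sigma>: "\<sigma> \<ge> 0" "\<sigma> \<le> 1" "\<sigma>\<^sup>2 = 1 - 1 / (1 + 2 * \<rho>)\<^sup>2" by (auto simp: \<sigma>_def)
  then have tau1: "\<tau> \<le> 1" using tau unfolding \<sigma>_def by linarith
  \<comment> \<open>Chosen so large that the truncation loss \<open>\<sigma> / r0\<close> stays
    below the gap \<open>\<sigma> - \<tau>\<close>.\<close>
  obtain r0 where r0: "real r0 > max 1 (\<sigma> / (\<sigma> - \<tau>))" using reals_Archimedean2 by blast
  define \<eta> where "\<eta> = \<sigma> - \<tau> - \<sigma> / real r0"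
  have "\<sigma> - \<tau> > 0" using tau by (simp add: \<sigma>_def)
  moreover have "real r0 > \<sigma> / (\<sigma> - \<tau>)" using r0 by simp
  ultimately have eta: "\<eta> > 0" using r0 by (simp add: \<eta>_def field_simps)
  define R where "R = r0 + 1"
  \<comment> \<open>The summand 1 added to \<open>R\<close> absorbs the rounding up of
    \<open>\<rho> * n\<close> to \<open>k0\<close>.\<close>
  define C where "C = (4 * \<rho> + 4 * (real R + 1) + 2) * exp ((real R + 1) * ln (1 + 1 / \<rho>))"
  \<comment> \<open>The maximum with 1 makes \<open>ln K\<close> nonnegative, which the bound for
    the empty code uses later.\<close>
  define K where "K = max 1 ((1 - \<tau>) / \<eta> * (real R * C))"
  show ?thesis
  proof (intro exI[of _ K] conjI allI impI)
    show "K \<ge> 1" by (simp add: K_def)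
    fix n X
    assume n: "n \<ge> (4::nat)" and "finite X" and "\<forall>x\<in>X. ipn n x x = 1"
      and "\<forall>x\<in>X. \<forall>y\<in>X. x \<noteq> y \<longrightarrow> ipn n x y \<le> \<tau>"
    then have X: "finite X" "\<And>x. x \<in> X \<Longrightarrow> ipn n x x = 1"
      "\<And>x y. x \<in> X \<Longrightarrow> y \<in> X \<Longrightarrow> x \<noteq> y \<Longrightarrow> ipn n x y \<le> \<tau>" by auto
    have d: "real n \<ge> 4" using n by simp
    define k0 where "k0 = nat \<lceil>\<rho> * real n\<rceil>"
    have k0: "real k0 \<ge> \<rho> * real n" "real k0 \<le> \<rho> * real n + 1"
      using r unfolding k0_def by (auto simp: of_nat_nat real_nat_ceiling_ge ceiling_correct)
    \<comment> \<open>A parabola vanishing at both ends of the window: its second difference is -2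
      inside, so the sum of the two neighbours falls short of \<open>2 * W i\<close> by only
      2.\<close>
    define W where "W i = (if k0 \<le> i \<and> i \<le> k0 + R then (real i - real k0) * (real k0 + real R - real i) else 0)" for i
    have W0: "W i \<ge> 0" for i by (auto simp: W_def)
    have Wi: "k0 < i \<and> i < k0 + R" if "W i \<noteq> 0" for i
      using that by (cases "i = k0 \<or> i = k0 + R") (auto simp: W_def split: if_splits)
    have lam: "sqrt (gegen_coeff (real n) i) \<ge> \<sigma> / 2" if "i \<ge> k0" for i
    proof (rule real_le_rsqrt)
      have "4 * (\<sigma> / 2)\<^sup>2 \<le> 4 * gegen_coeff (real n) k0"
        using gegen_coeff_lower[OF d r k0(1)] by (simp add: \<sigma> power_divide)
      then show "(\<sigma> / 2)\<^sup>2 \<le> gegen_coeff (real n) i" using gegen_coeff_mono[OF d that] by linarith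
    qed
    have V: "sqrt (gegen_coeff (real n) i) * W (i - 1) + sqrt (gegen_coeff (real n) (Suc i)) * W (Suc i)
       - \<tau> * W i \<ge> \<eta> * W i" for i
    proof (cases "W i = 0")
      case True
      then show ?thesis using W0 gegen_coeff_nonneg[OF d] by simp
    next
      case False
      define a where "a = real i - real k0"
      have i: "k0 < i" "i < k0 + R" using Wi[OF False] by auto
      have a: "a \<ge> 1" "a \<le> real r0" using i by (auto simp: a_def R_def)
      have W: "W i = a * (real R - a)" "W (i - 1) + W (Suc i) = 2 * W i - 2"
        using i by (auto simp: W_def a_def of_nat_diff algebra_simps)
      \<comment> \<open>Since \<open>R = r0 + 1\<close>, this product equals
        \<open>W i - r0\<close>.\<close>
      have "(a - 1) * (real r0 - a) \<ge> 0" using a by (intro mult_nonneg_nonneg) auto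
      then have Wr: "W i \<ge> real r0" unfolding W by (simp add: R_def algebra_simps)
      have "\<sigma> / 2 * W (i - 1) \<le> sqrt (gegen_coeff (real n) i) * W (i - 1)"
        "\<sigma> / 2 * W (Suc i) \<le> sqrt (gegen_coeff (real n) (Suc i)) * W (Suc i)"
        using i by (intro mult_right_mono lam W0; simp)+
      moreover have "\<sigma> / 2 * W (i - 1) + \<sigma> / 2 * W (Suc i) = \<sigma> * W i - \<sigma>"
        unfolding distrib_left[symmetric] W(2) by (simp add: algebra_simps)
      moreover have "\<sigma> \<le> \<sigma> / real r0 * W i"
      proof -
        have "\<sigma> / real r0 * real r0 \<le> \<sigma> / real r0 * W i" using \<sigma> Wr by (intro mult_left_mono) auto
        then show ?thesis using r0 by simp
      qed
      ultimately show ?thesis by (simp add: \<eta>_def algebra_simps)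
    qed
    define I where "I = {i. i < k0 + R \<and> W i \<noteq> 0}"
    have "\<eta> * real (card X) \<le> (1 - \<tau>) * (\<Sum>i\<in>I. (poly (gegen_on (real n) i) 1)\<^sup>2)"
      unfolding I_def
    proof (rule spherical_code_lp_bound[OF n X _ W0 _ _ eta V])
      show "\<tau> \<le> 1" by (rule tau1)
      show "W i = 0" if "k0 + R \<le> i" for i using Wi[of i] that by auto
      show "W (k0 + 1) > 0" using r0 by (simp add: W_def R_def)
    qed
    also have "\<dots> \<le> (1 - \<tau>) * (\<Sum>i\<in>I. C * exp (real n * kl_rate \<rho>))"
    proof (intro mult_left_mono sum_mono)
      fix i assume "i \<in> I"
      then have "real i \<le> \<rho> * real n + (real R + 1)" using k0 by (simp add: I_def)
      from gegen_on_at_one_le[OF n r this] show "(poly (gegen_on (real n) i) 1)\<^sup>2 \<le> C * exp (real n * kl_rate \<rho>)"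
        by (simp add: C_def)
    qed (use tau1 in simp)
    also have "\<dots> \<le> (1 - \<tau>) * (real R * (C * exp (real n * kl_rate \<rho>)))"
    proof -
      have "I \<subseteq> {k0<..<k0 + R}" using Wi by (auto simp: I_def)
      from card_mono[OF _ this] have "card I \<le> R" by simp
      then show ?thesis using r tau1 by (auto intro!: mult_left_mono mult_right_mono simp: C_def)
    qed
    finally have "real (card X) \<le> (1 - \<tau>) / \<eta> * (real R * C) * exp (real n * kl_rate \<rho>)"
      using eta by (simp add: field_simps)
    also have "\<dots> \<le> K * exp (real n * kl_rate \<rho>)"
      unfolding K_def by (intro mult_right_mono) auto
    finally show "real (card X) \<le> K * exp (real n * kl_rate \<rho>)" .
  qed
qed

section \<open>Principal angles\<close>

lemma ipn_add_left: "ipn n (\<lambda>j. x j + y j) z = ipn n x z + ipn n y z"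
  by (simp add: ipn_def distrib_right sum.distrib)

lemma ipn_scale_left: "ipn n (\<lambda>j. a * x j) z = a * ipn n x z"
  by (simp add: ipn_def sum_distrib_left mult.assoc)

lemma ipn_diff_left: "ipn n (\<lambda>j. x j - y j) z = ipn n x z - ipn n y z"
  by (simp add: ipn_def left_diff_distrib sum_subtractf)

lemma ipn_add_right: "ipn n z (\<lambda>j. x j + y j) = ipn n z x + ipn n z y"
  and ipn_scale_right: "ipn n z (\<lambda>j. a * x j) = a * ipn n z x"
  and ipn_diff_right: "ipn n z (\<lambda>j. x j - y j) = ipn n z x - ipn n z y"
  by (simp_all add: ipn_commute[of n z] ipn_add_left ipn_scale_left ipn_diff_left)

lemmas ipn_linear = ipn_add_left ipn_scale_left ipn_diff_left ipn_add_right ipn_scale_right ipn_diff_right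

lemma ipn_lincomb_left: "ipn n (lincomb k c b) z = (\<Sum>i<k. c i * ipn n (b i) z)"
  unfolding ipn_def lincomb_def sum_distrib_right sum_distrib_left
  by (subst sum.swap) (simp add: mult.assoc)

lemma ipn_lincomb_right: "ipn n z (lincomb k c b) = (\<Sum>i<k. c i * ipn n z (b i))"
  by (simp add: ipn_commute[of n z] ipn_lincomb_left)

lemma ipn_self_nonneg: "ipn n x x \<ge> 0"
  unfolding ipn_def by (intro sum_nonneg) auto

lemma ipn_self_eq_0: "x \<in> Rn n \<Longrightarrow> ipn n x x = 0 \<Longrightarrow> x = (\<lambda>_. 0)"
  by (rule ext) (auto simp: ipn_def Rn_def sum_nonneg_eq_0_iff Ball_def, metis not_le)

lemma lincomb_Suc: "lincomb (Suc k) c b = (\<lambda>j. lincomb k c b j + c k * b k j)"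
  by (simp add: lincomb_def)

lemma lincomb_cong: "(\<And>i. i < k \<Longrightarrow> c i = c' i) \<Longrightarrow> (\<And>i. i < k \<Longrightarrow> b i = b' i) \<Longrightarrow> lincomb k c b = lincomb k c' b'"
  by (auto simp: lincomb_def)

lemma lincomb_in_Rn: "(\<And>i. i < k \<Longrightarrow> b i \<in> Rn n) \<Longrightarrow> lincomb k c b \<in> Rn n"
  by (auto simp: Rn_def lincomb_def)

lemma lincomb_lin: "(\<lambda>j. s * lincomb k c b j + t * lincomb k d b j) = lincomb k (\<lambda>i. s * c i + t * d i) b"
  by (simp add: lincomb_def sum_distrib_left sum.distrib algebra_simps)

section \<open>Orthonormal bases of subspaces\<close>

definition onb :: "nat \<Rightarrow> nat \<Rightarrow> (nat \<Rightarrow> real) set \<Rightarrow> (nat \<Rightarrow> nat \<Rightarrow> real) \<Rightarrow> bool" where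
  "onb n k V u \<longleftrightarrow> (\<forall>i<k. u i \<in> Rn n) \<and> (\<forall>i<k. \<forall>j<k. ipn n (u i) (u j) = (if i = j then 1 else 0))
     \<and> V = {lincomb k c u | c. True}"

lemma onb_ipn: "onb n k V u \<Longrightarrow> i < k \<Longrightarrow> j < k \<Longrightarrow> ipn n (u i) (u j) = (if i = j then 1 else 0)"
  by (simp add: onb_def)

lemma onb_lincomb: "onb n k V u \<Longrightarrow> lincomb k c u \<in> V"
  by (auto simp: onb_def)

lemma onb_Rn: "onb n k V u \<Longrightarrow> x \<in> V \<Longrightarrow> x \<in> Rn n"
  by (auto simp: onb_def intro: lincomb_in_Rn)

lemma onb_ipn_lincomb:
  assumes "onb n k V u" "i < k"
  shows "ipn n (lincomb k c u) (u i) = c i"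
proof -
  have "ipn n (lincomb k c u) (u i) = (\<Sum>j<k. if j = i then c j else 0)"
    unfolding ipn_lincomb_left using assms by (intro sum.cong) (auto simp: onb_ipn)
  then show ?thesis using assms by simp
qed

lemma onb_expand:
  assumes "onb n k V u" "x \<in> V"
  shows "x = lincomb k (\<lambda>i. ipn n x (u i)) u"
proof -
  obtain c where c: "x = lincomb k c u" using assms by (auto simp: onb_def)
  show ?thesis unfolding c by (rule lincomb_cong) (simp_all add: onb_ipn_lincomb[OF assms(1)])
qed

lemma onb_basis_in: 
  assumes "onb n k V u" "i < k"
  shows "u i \<in> V"
proof -
  have "u i = lincomb k (\<lambda>j. if j = i then 1 else 0) u"
    using assms(2) by (auto simp: lincomb_def if_distrib[of "\<lambda>x. x * _"] cong: if_cong)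
  then show ?thesis using onb_lincomb[OF assms(1)] by metis
qed

lemma onb_lin:
  assumes "onb n k V u" "x \<in> V" "y \<in> V"
  shows "(\<lambda>j. s * x j + t * y j) \<in> V"
proof -
  obtain c d where c: "x = lincomb k c u" "y = lincomb k d u" using assms by (auto simp: onb_def)
  show ?thesis unfolding c lincomb_lin by (rule onb_lincomb[OF assms(1)])
qed

lemma onb_parseval:
  assumes "onb n k V u" "y \<in> V"
  shows "ipn n x y = (\<Sum>i<k. ipn n x (u i) * ipn n y (u i))"
  by (subst onb_expand[OF assms]) (simp add: ipn_lincomb_right mult.commute)

lemma onb_sum_squares_eq:
  assumes u: "onb n k V u" and v: "onb n k V v"
  shows "(\<Sum>i<k. (ipn n x (u i))\<^sup>2) = (\<Sum>i<k. (ipn n x (v i))\<^sup>2)"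
proof -
  have "(\<Sum>i<k. (ipn n x (u i))\<^sup>2) = (\<Sum>i<k. \<Sum>j<k. ipn n x (u i) * (ipn n x (v j) * ipn n (u i) (v j)))"
    unfolding power2_eq_square sum_distrib_left[symmetric]
    by (intro sum.cong refl arg_cong2[of _ _ _ _ "(*)"] onb_parseval[OF v] onb_basis_in[OF u]) auto
  also have "\<dots> = (\<Sum>j<k. ipn n x (v j) * (\<Sum>i<k. ipn n x (u i) * ipn n (v j) (u i)))"
    unfolding sum_distrib_left by (subst sum.swap) (simp add: mult_ac ipn_commute)
  also have "\<dots> = (\<Sum>j<k. (ipn n x (v j))\<^sup>2)"
    by (intro sum.cong refl) (simp add: onb_parseval[OF u onb_basis_in[OF v], symmetric] power2_eq_square)
  finally show ?thesis .
qed

text \<open>For orthonormal bases this is the trace of the product of the orthogonal projections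
  onto the two subspaces, hence independent of the bases.\<close>

definition overlap :: "nat \<Rightarrow> nat \<Rightarrow> (nat \<Rightarrow> nat \<Rightarrow> real) \<Rightarrow> (nat \<Rightarrow> nat \<Rightarrow> real) \<Rightarrow> real" where
  "overlap n k u v = (\<Sum>i<k. \<Sum>j<k. (ipn n (u i) (v j))\<^sup>2)"

lemma overlap_eq:
  assumes "onb n k P u" "onb n k P u'" "onb n k Q v" "onb n k Q v'"
  shows "overlap n k u v = overlap n k u' v'"
proof -
  have "overlap n k u v = (\<Sum>i<k. \<Sum>j<k. (ipn n (u i) (v' j))\<^sup>2)"
    unfolding overlap_def by (rule sum.cong[OF refl]) (rule onb_sum_squares_eq[OF assms(3,4)])
  also have "\<dots> = (\<Sum>j<k. \<Sum>i<k. (ipn n (v' j) (u i))\<^sup>2)"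
    by (subst sum.swap) (simp add: ipn_commute)
  also have "\<dots> = (\<Sum>j<k. \<Sum>i<k. (ipn n (v' j) (u' i))\<^sup>2)"
    by (rule sum.cong[OF refl]) (rule onb_sum_squares_eq[OF assms(1,2)])
  also have "\<dots> = overlap n k u' v'"
    unfolding overlap_def by (subst sum.swap) (simp add: ipn_commute)
  finally show ?thesis .
qed

text \<open>Gram-Schmidt: \<open>w\<close> is the part of \<open>b k\<close> orthogonal to the
  earlier vectors, and it is normalised by \<open>r\<close>.\<close>

lemma onb_exists:
  assumes "\<And>i. i < k \<Longrightarrow> b i \<in> Rn n"
    and "\<And>c. lincomb k c b = (\<lambda>_. 0) \<Longrightarrow> (\<forall>i<k. c i = 0)"
  shows "\<exists>u. onb n k {lincomb k c b | c. True} u"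
  using assms
proof (induction k)
  case 0
  show ?case by (auto simp: onb_def lincomb_def)
next
  case (Suc k)
  define V where "V = {lincomb k c b | c. True}"
  have "\<exists>u. onb n k V u"
    unfolding V_def
  proof (rule Suc.IH)
    fix c assume "lincomb k c b = (\<lambda>_. 0)"
    then have "lincomb (Suc k) (c(k := 0)) b = (\<lambda>_. 0)"
      using lincomb_cong[of k "c(k := 0)" c b b] by (simp add: lincomb_Suc)
    from Suc.prems(2)[OF this] show "\<forall>i<k. c i = 0" by (metis fun_upd_other less_SucI nat_neq_iff)
  qed (use Suc.prems in auto)
  then obtain u where u: "onb n k V u" by blast
  define p where "p = lincomb k (\<lambda>i. ipn n (b k) (u i)) u"
  have pV: "p \<in> V" unfolding p_def by (rule onb_lincomb[OF u])
  define w where "w = (\<lambda>j. b k j - p j)"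
  have wR: "w \<in> Rn n" using Suc.prems(1)[of k] onb_Rn[OF u pV] by (simp add: w_def Rn_def)
  have wu: "ipn n w (u i) = 0" if "i < k" for i
    using that by (simp add: w_def ipn_linear p_def onb_ipn_lincomb[OF u])
  \<comment> \<open>Otherwise \<open>b k\<close> would be a combination of the earlier vectors,
    against linear independence.\<close>
  have "ipn n w w \<noteq> 0"
  proof
    assume "ipn n w w = 0"
    then have "w = (\<lambda>_. 0)" using ipn_self_eq_0[OF wR] by simp
    then have "b k = p" unfolding w_def by (auto simp: fun_eq_iff)
    then obtain c where "b k = lincomb k c b" using pV by (auto simp: V_def)
    then have "lincomb (Suc k) (c(k := -1)) b = (\<lambda>_. 0)"
      using lincomb_cong[of k "c(k := -1)" c b b] by (simp add: lincomb_Suc)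
    from Suc.prems(2)[OF this] have "(c(k := -1)) k = 0" by blast
    then show False by simp
  qed
  then have ww: "ipn n w w > 0" using ipn_self_nonneg[of n w] by simp
  define r where "r = sqrt (ipn n w w)"
  have r: "r > 0" "r * r = ipn n w w" using ww by (auto simp: r_def)
  define a where "a = 1 / r"
  have a: "a * (a * ipn n w w) = 1" using r by (simp add: a_def r(2)[symmetric])
  define u' where "u' = u(k := (\<lambda>j. a * w j))"
  have lu': "lincomb (Suc k) c u' = (\<lambda>j. lincomb k c u j + c k / r * (b k j - p j))" for c
    using lincomb_cong[of k c c u' u] by (simp add: lincomb_Suc u'_def w_def a_def)
  have "onb n (Suc k) {lincomb (Suc k) c b | c. True} u'"
    unfolding onb_def
  proof (intro conjI allI impI)
    fix i assume "i < Suc k"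
    then show "u' i \<in> Rn n"
      using wR u by (cases "i = k") (auto simp: u'_def Rn_def onb_def)
    fix j assume "j < Suc k"
    then show "ipn n (u' i) (u' j) = (if i = j then 1 else 0)"
      using \<open>i < Suc k\<close> r wu u
      by (cases "i = k"; cases "j = k")
        (auto simp: u'_def ipn_scale_left ipn_scale_right onb_ipn ipn_commute[of n "u i" w] a)
  next
    show "{lincomb (Suc k) c b | c. True} = {lincomb (Suc k) c u' | c. True}"
    proof (intro equalityI subsetI; clarify)
      fix c
      have "lincomb k c b \<in> V" by (auto simp: V_def)
      from onb_lin[OF u this pV, of 1 "c k"]
      obtain e where e: "(\<lambda>j. 1 * lincomb k c b j + c k * p j) = lincomb k e u"
        using u by (auto simp: onb_def)
      have "lincomb (Suc k) c b = lincomb (Suc k) (e(k := c k * r)) u'"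
        unfolding lu' unfolding lincomb_Suc using lincomb_cong[of k "e(k := c k * r)" e u u] r e[symmetric]
        by (simp add: algebra_simps)
      then show "\<exists>e. lincomb (Suc k) c b = lincomb (Suc k) e u' \<and> True" by blast
    next
      fix c
      from onb_lin[OF u onb_lincomb[OF u, of c] pV, of 1 "- (c k / r)"]
      obtain e where e: "(\<lambda>j. 1 * lincomb k c u j + - (c k / r) * p j) = lincomb k e b"
        by (auto simp: V_def)
      have "lincomb (Suc k) c u' = lincomb (Suc k) (e(k := c k / r)) b"
        unfolding lu' unfolding lincomb_Suc using lincomb_cong[of k "e(k := c k / r)" e b b] e[symmetric]
        by (simp add: algebra_simps)
      then show "\<exists>e. lincomb (Suc k) c u' = lincomb (Suc k) e b \<and> True" by blast
    qed
  qed
  then show ?case by blast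
qed

lemma Grass_onb: "V \<in> Grass m n \<Longrightarrow> \<exists>u. onb n m V u"
  unfolding Grass_def using onb_exists by blast

text \<open>The Householder reflection exchanging \<open>u k\<close> and \<open>w\<close> carries the old basis to the new one.\<close>

lemma onb_last:
  assumes u: "onb n (Suc k) V u" and w: "w \<in> V" "ipn n w w = 1"
  shows "\<exists>u'. onb n (Suc k) V u' \<and> u' k = w"
proof -
  define z where "z = (\<lambda>j. 1 * w j + (-1) * u k j)"
  have ukV: "u k \<in> V" by (rule onb_basis_in[OF u]) simp
  have zV: "z \<in> V" unfolding z_def by (rule onb_lin[OF u w(1) ukV])
  have uk: "ipn n (u k) (u k) = 1" using onb_ipn[OF u, of k k] by simp
  show ?thesis
  proof (cases "ipn n z z = 0")
    case True
    then have "z = (\<lambda>_. 0)" using ipn_self_eq_0[OF onb_Rn[OF u zV]] by simp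
    then have "u k = w" by (auto simp: z_def fun_eq_iff)
    then show ?thesis using u by blast
  next
    case False
    define q where "q x = 2 * ipn n x z / ipn n z z" for x
    have qz: "q x * ipn n z z = 2 * ipn n x z" for x using False by (simp add: q_def)
    define H where "H x = (\<lambda>j. 1 * x j + (- q x) * z j)" for x
    have HV: "H x \<in> V" if "x \<in> V" for x unfolding H_def by (rule onb_lin[OF u that zV])
    have Hip: "ipn n (H x) (H y) = ipn n x y" for x y
    proof -
      have q: "q y * ipn n x z = q x * ipn n y z" by (simp add: q_def)
      have "ipn n (H x) (H y) = ipn n x y - q y * ipn n x z - q x * ipn n y z + q x * (q y * ipn n z z)"
        unfolding H_def by (simp add: ipn_linear ipn_commute[of n z y] algebra_simps)
      then show ?thesis unfolding q qz by simp
    qed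
    have HH: "H (H x) = x" for x
    proof -
      have "ipn n (H x) z = - ipn n x z"
        unfolding H_def by (simp add: ipn_linear qz)
      then have "q (H x) = - q x" by (simp add: q_def)
      then show ?thesis unfolding H_def[of "H x"] by (simp add: H_def)
    qed
    have Hlin: "H (lincomb l c b) = lincomb l c (\<lambda>i. H (b i))" for l c b
    proof (rule ext)
      fix j
      have "q (lincomb l c b) = (\<Sum>i<l. c i * q (b i))"
        by (simp add: q_def ipn_lincomb_left sum_distrib_left sum_divide_distrib mult_ac)
      then show "H (lincomb l c b) j = lincomb l c (\<lambda>i. H (b i)) j"
        by (simp add: H_def lincomb_def right_diff_distrib sum_subtractf sum_distrib_right mult.assoc)
    qed
    \<comment> \<open>As \<open>w\<close> and \<open>u k\<close> have equal length,
      \<open>q (u k) = -1\<close>, so the reflection adds exactly \<open>z = w - u k\<close> to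
      \<open>u k\<close>.\<close>
    have "ipn n z z = - 2 * ipn n (u k) z"
      using w uk by (simp add: z_def ipn_linear ipn_commute[of n w "u k"])
    then have Huk: "H (u k) = w" using False by (simp add: H_def q_def fun_eq_iff) (simp add: z_def)
    have "onb n (Suc k) V (\<lambda>i. H (u i))"
      unfolding onb_def
    proof (intro conjI allI impI)
      show "H (u i) \<in> Rn n" if "i < Suc k" for i
        by (intro onb_Rn[OF u] HV onb_basis_in[OF u] that)
      show "ipn n (H (u i)) (H (u j)) = (if i = j then 1 else 0)" if "i < Suc k" "j < Suc k" for i j
        unfolding Hip using onb_ipn[OF u that] .
      show "V = {lincomb (Suc k) c (\<lambda>i. H (u i)) | c. True}"
      proof (intro equalityI subsetI)
        fix x assume "x \<in> V"
        from HV[OF this] obtain c where "H x = lincomb (Suc k) c u" using u by (auto simp: onb_def)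
        then have "x = lincomb (Suc k) c (\<lambda>i. H (u i))" using HH[of x] by (simp add: Hlin)
        then show "x \<in> {lincomb (Suc k) c (\<lambda>i. H (u i)) | c. True}" by blast
      qed (auto simp: Hlin[symmetric] intro!: HV onb_lincomb[OF u])
    qed
    then show ?thesis using Huk by (intro exI[of _ "\<lambda>i. H (u i)"]) simp
  qed
qed

lemma onb_complement:
  assumes u: "onb n (Suc k) V u"
  shows "onb n k {x \<in> V. ipn n x (u k) = 0} u"
  unfolding onb_def
proof (intro conjI allI impI)
  show "{x \<in> V. ipn n x (u k) = 0} = {lincomb k c u | c. True}"
  proof (intro equalityI subsetI)
    fix x assume "x \<in> {x \<in> V. ipn n x (u k) = 0}"
    then have "x = lincomb k (\<lambda>i. ipn n x (u i)) u"
      using onb_expand[OF u, of x] by (simp add: lincomb_Suc)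
    then show "x \<in> {lincomb k c u | c. True}" by blast
  next
    fix x assume "x \<in> {lincomb k c u | c. True}"
    then obtain c where "x = lincomb k c u" by blast
    then have x: "x = lincomb (Suc k) (c(k := 0)) u"
      using lincomb_cong[of k "c(k := 0)" c u u] by (simp add: lincomb_Suc)
    show "x \<in> {x \<in> V. ipn n x (u k) = 0}"
      unfolding x using onb_lincomb[OF u] onb_ipn_lincomb[OF u, of k] by auto
  qed
qed (use u in \<open>auto simp: onb_def\<close>)

text \<open>Coordinates from \<open>k\<close> on are pinned to 0, which puts the set inside a
  product of compact intervals, where Tychonoff applies.\<close>

lemma compact_coordinate_sphere:
  "compact {c :: nat \<Rightarrow> real. (\<forall>i. \<bar>c i\<bar> \<le> (if i < k then 1 else 0)) \<and> (\<Sum>i<k. (c i)\<^sup>2) = 1}"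
proof -
  define B :: "(nat \<Rightarrow> real) set" where "B = PiE UNIV (\<lambda>i. {- (if i < k then 1 else 0)..(if i < k then 1 else 0)})"
  have "compactin (product_topology (\<lambda>i. euclidean) UNIV) B"
    unfolding B_def compactin_PiE by (auto simp: compactin_euclidean_iff)
  then have "compact B" by (simp add: euclidean_product_topology compactin_euclidean_iff)
  moreover have "closed {c :: nat \<Rightarrow> real. (\<Sum>i<k. (c i)\<^sup>2) = 1}"
    by (intro closed_Collect_eq continuous_intros continuous_on_product_coordinates)
  ultimately have "compact (B \<inter> {c. (\<Sum>i<k. (c i)\<^sup>2) = 1})" by (rule compact_Int_closed)
  also have "B \<inter> {c. (\<Sum>i<k. (c i)\<^sup>2) = 1} = {c. (\<forall>i. \<bar>c i\<bar> \<le> (if i < k then 1 else 0)) \<and> (\<Sum>i<k. (c i)\<^sup>2) = 1}"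
    by (auto simp: B_def PiE_def Pi_def abs_le_iff)
  finally show ?thesis .
qed

text \<open>A continuous function on a compact set attains its maximum. Existence matters because
  \<open>cos2_angles\<close> selects its pair by \<open>SOME\<close>.\<close>

lemma principal_pair_exists:
  assumes u: "onb n (Suc k) P u" and v: "onb n (Suc k) Q v"
  shows "\<exists>x y. x \<in> P \<and> y \<in> Q \<and> ipn n x x = 1 \<and> ipn n y y = 1 \<and>
    (\<forall>x'\<in>P. \<forall>y'\<in>Q. ipn n x' x' = 1 \<longrightarrow> ipn n y' y' = 1 \<longrightarrow> \<bar>ipn n x' y'\<bar> \<le> \<bar>ipn n x y\<bar>)"
proof -
  define S :: "(nat \<Rightarrow> real) set" where
    "S = {c. (\<forall>i. \<bar>c i\<bar> \<le> (if i < Suc k then 1 else 0)) \<and> (\<Sum>i<Suc k. (c i)\<^sup>2) = 1}"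
  have self: "ipn n (lincomb (Suc k) c b) (lincomb (Suc k) c b) = (\<Sum>i<Suc k. (c i)\<^sup>2)" if "onb n (Suc k) V b" for c V b
    unfolding ipn_lincomb_right using onb_ipn_lincomb[OF that] by (simp add: power2_eq_square)
  have param: "\<exists>c\<in>S. x = lincomb (Suc k) c b" if "onb n (Suc k) V b" "x \<in> V" "ipn n x x = 1" for V b x
  proof -
    define c where "c i = (if i < Suc k then ipn n x (b i) else 0)" for i
    have x: "x = lincomb (Suc k) c b"
      using onb_expand[OF that(1,2)] lincomb_cong[of "Suc k" c "\<lambda>i. ipn n x (b i)" b b] by (simp add: c_def)
    then have s: "(\<Sum>i<Suc k. (c i)\<^sup>2) = 1" using self[OF that(1), of c] that(3) by simp
    have "\<bar>c i\<bar> \<le> 1" if "i < Suc k" for i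
    proof -
      have "(c i)\<^sup>2 \<le> (\<Sum>i<Suc k. (c i)\<^sup>2)" using that by (intro member_le_sum) auto
      then show ?thesis by (simp only: s abs_square_le_1)
    qed
    then have "c \<in> S" using s by (auto simp: S_def c_def)
    then show ?thesis using x by blast
  qed
  \<comment> \<open>The objective in terms of coefficients and the finite matrix of inner products,
    so that continuity follows from that of the coordinates.\<close>
  define g where "g = (\<lambda>(c, d). \<bar>\<Sum>i<Suc k. c i * (\<Sum>j<Suc k. d j * ipn n (u i) (v j))\<bar>)"
  have g: "g (c, d) = \<bar>ipn n (lincomb (Suc k) c u) (lincomb (Suc k) d v)\<bar>" for c d
    unfolding g_def prod.case ipn_lincomb_left[where b = u] unfolding ipn_lincomb_right[where b = v] ..
  have "compact (S \<times> S)" unfolding S_def by (intro compact_Times compact_coordinate_sphere)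
  moreover have "(\<lambda>i. if i = 0 then 1 else 0) \<in> S"
    by (auto simp: S_def sum.lessThan_Suc_shift if_distrib[of "\<lambda>x. x\<^sup>2"] simp del: sum.lessThan_Suc cong: if_cong)
  then have "S \<times> S \<noteq> {}" by blast
  moreover have coord: "continuous_on (S \<times> S) (\<lambda>p. fst p i)" "continuous_on (S \<times> S) (\<lambda>p. snd p i)" for i
    using continuous_on_compose2[OF continuous_on_product_coordinates[of i] continuous_on_fst[OF continuous_on_id]]
      continuous_on_compose2[OF continuous_on_product_coordinates[of i] continuous_on_snd[OF continuous_on_id]] by auto
  have "continuous_on (S \<times> S) g"
    unfolding g_def case_prod_beta by (intro continuous_intros coord)
  ultimately obtain p where p: "p \<in> S \<times> S" "\<forall>q\<in>S \<times> S. g q \<le> g p"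
    using continuous_attains_sup[of "S \<times> S" g] by blast
  obtain c d where cd: "p = (c, d)" "c \<in> S" "d \<in> S" using p by (cases p) auto
  show ?thesis
  proof (intro exI conjI ballI impI)
    show "lincomb (Suc k) c u \<in> P" "lincomb (Suc k) d v \<in> Q" by (rule onb_lincomb u v)+
    show "ipn n (lincomb (Suc k) c u) (lincomb (Suc k) c u) = 1" "ipn n (lincomb (Suc k) d v) (lincomb (Suc k) d v) = 1"
      using cd by (simp_all only: self[OF u] self[OF v]) (simp_all add: S_def)
    fix x y assume "x \<in> P" "y \<in> Q" "ipn n x x = 1" "ipn n y y = 1"
    with param[OF u] param[OF v] obtain c' d' where "c' \<in> S" "d' \<in> S" "x = lincomb (Suc k) c' u" "y = lincomb (Suc k) d' v" by metis
    then show "\<bar>ipn n x y\<bar> \<le> \<bar>ipn n (lincomb (Suc k) c u) (lincomb (Suc k) d v)\<bar>"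
      using p(2) cd by (auto simp: g[symmetric])
  qed
qed

text \<open>Turning \<open>x\<close> towards \<open>z\<close> would help otherwise: with
  \<open>a\<close>, \<open>b\<close> the inner products of \<open>x\<close>, \<open>z\<close> with
  \<open>y\<close>, the unit vector along \<open>a x + b z\<close> has inner product
  \<open>sqrt (a^2 + b^2)\<close> with \<open>y\<close>, which exceeds \<open>\<bar>a\<bar>\<close>
  unless \<open>b = 0\<close>.\<close>

lemma maximal_pair_orthogonal:
  assumes u: "onb n k P u" and xy: "x \<in> P" "ipn n x x = 1"
    and max: "\<And>x'. x' \<in> P \<Longrightarrow> ipn n x' x' = 1 \<Longrightarrow> \<bar>ipn n x' y\<bar> \<le> \<bar>ipn n x y\<bar>"
    and z: "z \<in> P" "ipn n z z = 1" "ipn n z x = 0"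
  shows "ipn n z y = 0"
proof (rule ccontr)
  assume nz: "ipn n z y \<noteq> 0"
  define a b where "a = ipn n x y" and "b = ipn n z y"
  define r where "r = sqrt (a\<^sup>2 + b\<^sup>2)"
  have r: "r > 0" "r * r = a\<^sup>2 + b\<^sup>2" using nz by (auto simp: r_def b_def add_nonneg_pos)
  define \<alpha> \<beta> where "\<alpha> = a / r" and "\<beta> = b / r"
  have \<alpha>\<beta>: "\<alpha> * \<alpha> + \<beta> * \<beta> = 1"
  proof -
    have "\<alpha> * \<alpha> + \<beta> * \<beta> = (a\<^sup>2 + b\<^sup>2) / (r * r)"
      by (simp add: \<alpha>_def \<beta>_def power2_eq_square add_divide_distrib)
    then show ?thesis using r(1) unfolding r(2)[symmetric] by simp
  qed
  define q where "q = (\<lambda>j. \<alpha> * x j + \<beta> * z j)"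
  have "q \<in> P" unfolding q_def by (rule onb_lin[OF u xy(1) z(1)])
  moreover have "ipn n q q = 1"
    using xy z \<alpha>\<beta> by (simp add: q_def ipn_linear ipn_commute[of n x z])
  ultimately have "\<bar>ipn n q y\<bar> \<le> \<bar>a\<bar>" using max by (simp add: a_def)
  also have "ipn n q y = \<alpha> * a + \<beta> * b" by (simp add: q_def ipn_linear a_def b_def)
  also have "\<dots> = (a\<^sup>2 + b\<^sup>2) / r" by (simp add: \<alpha>_def \<beta>_def power2_eq_square add_divide_distrib)
  also have "\<dots> = r" using r by (simp add: field_simps)
  finally have "r\<^sup>2 \<le> a\<^sup>2" using r by (simp add: abs_le_square_iff[symmetric])
  then have "b\<^sup>2 \<le> 0" using r by (simp add: power2_eq_square)
  then show False using nz by (simp add: b_def)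
qed

text \<open>In bases ending with the selected pair, the last row and column of the matrix of inner
  products vanish off the diagonal. So the overlap splits into the first squared cosine and the
  overlap of the two complements, and it does not depend on the bases.\<close>

lemma sum_cos2_angles:
  assumes "onb n k P u" "onb n k Q v"
  shows "sum_list (cos2_angles n k P Q) = overlap n k u v"
  using assms
proof (induction k arbitrary: P Q u v)
  case 0
  show ?case by (simp add: overlap_def)
next
  case (Suc k)
  define good where "good = (\<lambda>(u, v). u \<in> P \<and> v \<in> Q \<and> ipn n u u = 1 \<and> ipn n v v = 1 \<and>
    (\<forall>u'\<in>P. \<forall>v'\<in>Q. ipn n u' u' = 1 \<longrightarrow> ipn n v' v' = 1 \<longrightarrow> \<bar>ipn n u' v'\<bar> \<le> \<bar>ipn n u v\<bar>))"
  obtain x y where xy: "(SOME p. good p) = (x, y)" by (cases "SOME p. good p")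
  have "\<exists>p. good p" using principal_pair_exists[OF Suc.prems] by (auto simp: good_def)
  from someI_ex[OF this] have good: "x \<in> P" "y \<in> Q" "ipn n x x = 1" "ipn n y y = 1"
    "\<And>u' v'. u' \<in> P \<Longrightarrow> v' \<in> Q \<Longrightarrow> ipn n u' u' = 1 \<Longrightarrow> ipn n v' v' = 1 \<Longrightarrow> \<bar>ipn n u' v'\<bar> \<le> \<bar>ipn n x y\<bar>"
    unfolding xy by (auto simp: good_def)
  obtain u' where u': "onb n (Suc k) P u'" "u' k = x" using onb_last[OF Suc.prems(1) good(1,3)] by blast
  obtain v' where v': "onb n (Suc k) Q v'" "v' k = y" using onb_last[OF Suc.prems(2) good(2,4)] by blast
  have max: "\<bar>ipn n z y\<bar> \<le> \<bar>ipn n x y\<bar>" if "z \<in> P" "ipn n z z = 1" for z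
    using good that by blast
  have max': "\<bar>ipn n z x\<bar> \<le> \<bar>ipn n y x\<bar>" if "z \<in> Q" "ipn n z z = 1" for z
    using good(5)[OF good(1) that(1) good(3) that(2)] by (simp add: ipn_commute)
  have c1: "ipn n (u' i) (v' k) = 0" if "i < k" for i
  proof -
    have "u' i \<in> P" "ipn n (u' i) (u' i) = 1" "ipn n (u' i) x = 0"
      using that onb_basis_in[OF u'(1), of i] onb_ipn[OF u'(1), of i i] onb_ipn[OF u'(1), of i k] u'(2) by auto
    then show ?thesis unfolding v'(2) using maximal_pair_orthogonal[OF u'(1) good(1,3) max] by blast
  qed
  have c2: "ipn n (u' k) (v' j) = 0" if "j < k" for j
  proof -
    have "v' j \<in> Q" "ipn n (v' j) (v' j) = 1" "ipn n (v' j) y = 0"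
      using that onb_basis_in[OF v'(1), of j] onb_ipn[OF v'(1), of j j] onb_ipn[OF v'(1), of j k] v'(2) by auto
    then show ?thesis unfolding u'(2) ipn_commute[of n x "v' j"]
      using maximal_pair_orthogonal[OF v'(1) good(2,4) max'] by blast
  qed
  have "sum_list (cos2_angles n (Suc k) P Q)
      = (ipn n x y)\<^sup>2 + sum_list (cos2_angles n k {z \<in> P. ipn n z x = 0} {z \<in> Q. ipn n z y = 0})"
    using xy unfolding good_def by (simp add: Let_def)
  also have "sum_list (cos2_angles n k {z \<in> P. ipn n z x = 0} {z \<in> Q. ipn n z y = 0}) = overlap n k u' v'"
    using onb_complement[OF u'(1)] onb_complement[OF v'(1)] unfolding u'(2) v'(2) by (rule Suc.IH)
  also have "(ipn n x y)\<^sup>2 + overlap n k u' v' = overlap n (Suc k) u' v'"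
    by (simp add: overlap_def c1 c2 sum.distrib u'(2)[symmetric] v'(2)[symmetric])
  also have "\<dots> = overlap n (Suc k) u v" by (rule overlap_eq[OF u'(1) Suc.prems(1) v'(1) Suc.prems(2)])
  finally show ?case .
qed

section \<open>Codes in Grassmannians\<close>

definition stack :: "nat \<Rightarrow> nat \<Rightarrow> (nat \<Rightarrow> nat \<Rightarrow> real) \<Rightarrow> nat \<Rightarrow> real" where
  "stack m n u = (\<lambda>k. u (k div n) (k mod n) / sqrt (real m))"

lemma sum_div_mod:
  fixes f :: "nat \<Rightarrow> nat \<Rightarrow> real"
  shows "(\<Sum>k<m * n. f (k div n) (k mod n)) = (\<Sum>i<m. \<Sum>j<n. f i j)"
proof (cases "n = 0")
  case False
  have less: "i * n + j < m * n" if "i < m" "j < n" for i j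
  proof -
    have "i * n + j < (i + 1) * n" using that by simp
    also have "\<dots> \<le> m * n" using that by (intro mult_le_mono1) simp
    finally show ?thesis .
  qed
  have "(\<Sum>k<m * n. f (k div n) (k mod n)) = (\<Sum>(i, j)\<in>{..<m} \<times> {..<n}. f i j)"
    by (rule sum.reindex_bij_witness[of _ "\<lambda>(i, j). i * n + j" "\<lambda>k. (k div n, k mod n)"])
      (use False in \<open>auto simp: less_mult_imp_div_less less\<close>)
  then show ?thesis by (simp add: sum.cartesian_product)
qed simp

lemma ipn_stack: "ipn (m * n) (stack m n u) (stack m n v) = (\<Sum>i<m. ipn n (u i) (v i)) / real m"
proof -
  have "ipn (m * n) (stack m n u) (stack m n v) = (\<Sum>k<m * n. u (k div n) (k mod n) * v (k div n) (k mod n) / real m)"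
    by (simp add: ipn_def stack_def)
  also have "\<dots> = (\<Sum>i<m. \<Sum>j<n. u i j * v i j / real m)"
    by (rule sum_div_mod[of "\<lambda>i j. u i j * v i j / real m"])
  finally show ?thesis by (simp add: ipn_def sum_divide_distrib)
qed

text \<open>Dropping the terms \<open>i \<noteq> j\<close> of the overlap and applying
  Cauchy-Schwarz against the all-ones vector gives \<open>t^2 \<le> m * s\<close>; the scaling of
  \<open>stack\<close> divides \<open>t\<close> by \<open>m\<close>.\<close>

lemma ipn_stack_le:
  assumes m: "m \<ge> 1" and s: "overlap n m u v \<le> s"
  shows "ipn (m * n) (stack m n u) (stack m n v) \<le> sqrt (s / real m)"
proof -
  define t where "t = (\<Sum>i<m. ipn n (u i) (v i))"
  have "(\<Sum>i<m. (ipn n (u i) (v i))\<^sup>2) \<le> overlap n m u v"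
    unfolding overlap_def
  proof (rule sum_mono)
    fix i assume "i \<in> {..<m}"
    then show "(ipn n (u i) (v i))\<^sup>2 \<le> (\<Sum>j<m. (ipn n (u i) (v j))\<^sup>2)"
      by (intro member_le_sum) auto
  qed
  with s have "real m * (\<Sum>i<m. (ipn n (u i) (v i))\<^sup>2) \<le> real m * s"
    by (intro mult_left_mono) auto
  moreover have "t\<^sup>2 \<le> real m * (\<Sum>i<m. (ipn n (u i) (v i))\<^sup>2)"
    using Cauchy_Schwarz_ineq_sum[of "\<lambda>_. 1" "\<lambda>i. ipn n (u i) (v i)" "{..<m}"] by (simp add: t_def)
  ultimately have "t\<^sup>2 \<le> real m * s" by linarith
  then have "(t / real m)\<^sup>2 \<le> s / real m"
    using m by (simp add: power_divide power2_eq_square field_simps)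
  then show ?thesis unfolding ipn_stack t_def[symmetric] by (rule real_le_rsqrt)
qed

lemma code_gives_spherical_code:
  assumes m: "m \<ge> 1" and s: "s < real m" and C: "is_code m n (sqrt (real m - s)) C"
  obtains X where "finite X" "card X = card C" "\<And>x. x \<in> X \<Longrightarrow> ipn (m * n) x x = 1"
    "\<And>x y. x \<in> X \<Longrightarrow> y \<in> X \<Longrightarrow> x \<noteq> y \<Longrightarrow> ipn (m * n) x y \<le> sqrt (s / real m)"
proof -
  have "\<forall>p\<in>C. \<exists>u. onb n m p u" using C by (auto simp: is_code_def intro: Grass_onb)
  then obtain u where u: "\<And>p. p \<in> C \<Longrightarrow> onb n m p (u p)" by metis
  define w where "w p = stack m n (u p)" for p
  have unit: "ipn (m * n) (w p) (w p) = 1" if "p \<in> C" for p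
  proof -
    have "(\<Sum>i<m. ipn n (u p i) (u p i)) = (\<Sum>i<m. 1)"
      by (intro sum.cong refl) (simp add: onb_ipn[OF u[OF that]])
    then show ?thesis using m by (simp add: w_def ipn_stack)
  qed
  have sep: "ipn (m * n) (w p) (w q) \<le> sqrt (s / real m)" if "p \<in> C" "q \<in> C" "p \<noteq> q" for p q
  proof -
    have "sqrt (real m - s) \<le> sqrt (real m - sum_list (cos2_angles n m p q))"
      using C that by (simp add: is_code_def chordal_dist_def)
    \<comment> \<open>\<open>sqrt\<close> is strictly increasing on all reals, so the radicands can
      be compared whatever their signs.\<close>
    then have "overlap n m (u p) (u q) \<le> s"
      using sum_cos2_angles[OF u[OF that(1)] u[OF that(2)]] by simp
    then show ?thesis unfolding w_def by (rule ipn_stack_le[OF m])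
  qed
  \<comment> \<open>Two code points with the same stacked vector would have inner product 1, so
    stacking is injective on the code and preserves its size.\<close>
  have "sqrt (s / real m) < 1" using s m by simp
  then have inj: "inj_on w C" using unit sep by (intro inj_onI) (metis not_less)
  show ?thesis
  proof (rule that[of "w ` C"])
    show "finite (w ` C)" using C by (simp add: is_code_def)
    show "card (w ` C) = card C" using inj by (rule card_image)
  qed (use unit sep in auto)
qed

lemma kl_rate_nonneg:
  assumes "\<rho> > 0"
  shows "kl_rate \<rho> \<ge> 0"
proof -
  have "\<rho> * ln \<rho> \<le> \<rho> * ln (1 + \<rho>)" using assms by (intro mult_left_mono) auto
  moreover have "ln (1 + \<rho>) \<ge> 0" using assms by simp
  ultimately show ?thesis by (simp add: kl_rate_def algebra_simps)
qed

text \<open>The factor \<open>m\<close> arises because the spherical bound is applied in dimension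
  \<open>m * n\<close> while the logarithm is divided by \<open>n\<close>. The bound is uniform over
  codes, and \<open>ln K / n\<close> tends to 0.\<close>

lemma code_limsup_le:
  assumes m: "m \<ge> 1" and s: "s < real m" and r: "\<rho> > 0"
    and lt: "sqrt (s / real m) < sqrt (1 - 1 / (1 + 2 * \<rho>)\<^sup>2)"
  shows "limsup (\<lambda>n. Sup {ereal (ln (real (card C)) / real n) | C. is_code m n (sqrt (real m - s)) C})
    \<le> ereal (real m * kl_rate \<rho>)"
proof -
  obtain K where K: "K \<ge> 1" and kl: "\<forall>n X. n \<ge> 4 \<longrightarrow> finite X \<longrightarrow> (\<forall>x\<in>X. ipn n x x = 1) \<longrightarrow>
      (\<forall>x\<in>X. \<forall>y\<in>X. x \<noteq> y \<longrightarrow> ipn n x y \<le> sqrt (s / real m)) \<longrightarrow>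
      real (card X) \<le> K * exp (real n * kl_rate \<rho>)"
    using kabatiansky_levenshtein[OF r lt] by blast
  have bound: "ln (real (card C)) / real n \<le> ln K / real n + real m * kl_rate \<rho>"
    if n: "n \<ge> 4" and C: "is_code m n (sqrt (real m - s)) C" for n C
  proof -
    obtain X where X: "finite X" "card X = card C" "\<And>x. x \<in> X \<Longrightarrow> ipn (m * n) x x = 1"
      "\<And>x y. x \<in> X \<Longrightarrow> y \<in> X \<Longrightarrow> x \<noteq> y \<Longrightarrow> ipn (m * n) x y \<le> sqrt (s / real m)"
      using code_gives_spherical_code[OF m s C] by blast
    have "m * n \<ge> 1 * 4" using m n by (intro mult_le_mono)
    then have card: "real (card C) \<le> K * exp (real (m * n) * kl_rate \<rho>)"
      using kl[rule_format, of "m * n" X] X by simp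
    have "ln (real (card C)) \<le> ln K + real (m * n) * kl_rate \<rho>"
    proof (cases "card C = 0")
      \<comment> \<open>Here \<open>ln 0 = 0\<close>, so a nonnegative right-hand side
        suffices.\<close>
      case True
      then show ?thesis using K kl_rate_nonneg[OF r] by simp
    next
      case False
      then have "ln (real (card C)) \<le> ln (K * exp (real (m * n) * kl_rate \<rho>))"
        using card K by (subst ln_le_cancel_iff) auto
      then show ?thesis using K by (simp add: ln_mult)
    qed
    then have "ln (real (card C)) / real n \<le> (ln K + real (m * n) * kl_rate \<rho>) / real n"
      by (rule divide_right_mono) simp
    also have "\<dots> = ln K / real n + real m * kl_rate \<rho>" using n by (simp add: field_simps)
    finally show ?thesis .
  qed
  have "limsup (\<lambda>n. Sup {ereal (ln (real (card C)) / real n) | C. is_code m n (sqrt (real m - s)) C})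
      \<le> limsup (\<lambda>n. ereal (ln K / real n + real m * kl_rate \<rho>))"
  proof (rule Limsup_mono)
    show "\<forall>\<^sub>F n in sequentially. Sup {ereal (ln (real (card C)) / real n) | C. is_code m n (sqrt (real m - s)) C}
        \<le> ereal (ln K / real n + real m * kl_rate \<rho>)"
      using eventually_ge_at_top[of 4]
      by eventually_elim (auto intro!: Sup_least bound)
  qed
  also have "(\<lambda>n. ln K / real n + real m * kl_rate \<rho>) \<longlonglongrightarrow> 0 + real m * kl_rate \<rho>"
    by (intro tendsto_add tendsto_const lim_const_over_n)
  then have "limsup (\<lambda>n. ereal (ln K / real n + real m * kl_rate \<rho>)) = ereal (real m * kl_rate \<rho>)"
    by (intro lim_imp_Limsup) auto
  finally show ?thesis .
qed

theorem theorem1: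
  fixes m :: nat and s \<delta> \<rho> :: real
  assumes "m \<ge> 1" and "0 < s" and "s < real m"
    and "\<delta> = sqrt (real m - s)"
    and "\<rho> = real m / 2 * (-1 + (1 - s / real m) powr (-1/2))"
  shows "limsup (\<lambda>n. Sup {ereal (ln (real (card C)) / real n) | C. is_code m n \<delta> C})
           \<le> ereal (real m * ((1 + \<rho>) * ln (1 + \<rho>) - \<rho> * ln \<rho>))"
proof -
  define t where "t = 1 - s / real m"
  have t: "0 < t" "t < 1" using assms(1-3) by (auto simp: t_def)
  define r where "r = t powr (-1/2)"
  have "t powr (-1/2) * t powr (-1/2) = t powr (-1)" by (simp add: powr_add[symmetric] del: powr_neg_one)
  also have "\<dots> = 1 / t" using t by (simp add: powr_minus_divide)
  finally have r2: "r\<^sup>2 = 1 / t" by (simp only: r_def power2_eq_square)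
  have "r > 0" using t by (simp add: r_def)
  moreover have "r\<^sup>2 > 1\<^sup>2" unfolding r2 using t by simp
  ultimately have r1: "r > 1" using power_less_imp_less_base by fastforce
  have \<rho>: "\<rho> = real m * ((r - 1) / 2)" using assms(5) by (simp add: r_def t_def field_simps)
  then have \<rho>_ge: "\<rho> \<ge> (r - 1) / 2" using assms(1) r1 by simp
  then have \<rho>_pos: "\<rho> > 0" using r1 by simp
  \<comment> \<open>For \<open>m = 1\<close> one has \<open>1 + 2 * \<rho> = r\<close>, and the
    strict inequality demanded by \<open>code_limsup_le\<close> fails at \<open>\<rho>\<close>
    itself; so the bound is first proved for every larger \<open>\<rho>'\<close>.\<close>
  have le: "limsup (\<lambda>n. Sup {ereal (ln (real (card C)) / real n) | C. is_code m n \<delta> C})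
      \<le> ereal (real m * kl_rate \<rho>')" if "\<rho>' > \<rho>" for \<rho>'
    unfolding assms(4)
  proof (rule code_limsup_le[OF assms(1,3)])
    show "\<rho>' > 0" using that \<rho>_pos by simp
    have "r < 1 + 2 * \<rho>'" using \<rho>_ge that by simp
    then have "r\<^sup>2 < (1 + 2 * \<rho>')\<^sup>2" using r1 by (intro power_strict_mono) auto
    then have "1 / (1 + 2 * \<rho>')\<^sup>2 < 1 / r\<^sup>2"
      using r1 that \<rho>_pos by (intro divide_strict_left_mono mult_pos_pos zero_less_power) auto
    also have "1 / r\<^sup>2 = t" by (simp add: r2)
    finally show "sqrt (s / real m) < sqrt (1 - 1 / (1 + 2 * \<rho>')\<^sup>2)" by (simp add: t_def)
  qed
  \<comment> \<open>Continuity of \<open>kl_rate\<close> at \<open>\<rho> > 0\<close> lets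
    \<open>\<rho>'\<close> decrease to \<open>\<rho>\<close>.\<close>
  have "(\<lambda>n. real m * kl_rate (\<rho> + 1 / real (Suc n))) \<longlonglongrightarrow> real m * kl_rate (\<rho> + 0)"
    unfolding kl_rate_def using \<rho>_pos
    by (intro tendsto_intros LIMSEQ_Suc[OF lim_1_over_n]) auto
  then have "(\<lambda>n. ereal (real m * kl_rate (\<rho> + 1 / real (Suc n)))) \<longlonglongrightarrow> ereal (real m * kl_rate \<rho>)"
    by simp
  then have "limsup (\<lambda>n. Sup {ereal (ln (real (card C)) / real n) | C. is_code m n \<delta> C})
      \<le> ereal (real m * kl_rate \<rho>)"
    by (rule LIMSEQ_le_const) (intro exI allI impI le, simp)
  then show ?thesis by (simp add: kl_rate_def)
qed

end
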